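(* For a tree $T$, the graph obtained by adding to $T$ the edges produced by the algorithm tree-augment (described in the context) is 2-vertex-connected.
   Context: A graph is 2-vertex-connected if it is connected and remains connected after removing any single vertex. A representative of a tree is a vertex of degree at least $3$ that is adjacent to at least one leaf; for a representative $R_i$, $L_i$ denotes the set of leaves adjacent to $R_i$, $l_i=|L_i|$, and $d_i$ is the degree of $R_i$. A path-to-edge contraction replaces a path $u=u_1,u_2,\dots,u_r=v$ all of whose internal vertices have degree exactly $2$ by the single edge $\{u,v\}$ (deleting $u_2,\dots,u_{r-1}$); it is applied to such paths where both endpoints have degree at least $3$, or one endpoint has degree at least $3$ and the other is a leaf. The algorithm tree-augment($T$): if $T$ has exactly two leaves $x,y$, add the edge $\{x,y\}$ and stop. Otherwise, perform all path-to-edge contractions and compute the representatives. If there is exactly one representative (the contracted tree is a star), perform star-augment, which adds $\Delta-1$ edges among the leaves so that the result is 2-connected. Otherwise (non-star case): choose representatives $R_i,R_j$ of maximum and second-maximum degree; set $t=l_j-1$ if $d_i-l_i=1$ and $d_j-l_j=1$; if $d_i-l_i\neq 1$ and $d_j-l_j=1$, set $t=l_i$ when $\min(l_i,l_j)=l_i$ and $t=l_j-1$ otherwise; if $d_i-l_i=1$ and $d_j-l_j\neq1$, set $t=l_j$; otherwise $t=\min(l_i,l_j)$. Pick $t$ leaves $x_1,\dots,x_t\in L_i$ and $t$ leaves $y_1,\dots,y_t\in L_j$, add the edges $\{x_k,y_k\}$ ($1\le k\le t$), delete these $2t$ leaves to obtain a smaller tree, update the representatives, and repeat the procedure on the new tree.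 *)

theory Defs
  imports "Graph_Theory.Digraph_Component" "Graph_Theory.Vertex_Walk"
begin

text \<open>
  A finite simple graph is a \<^locale>\<open>pair_graph\<close>: a finite loop-free symmetric digraph, in which the
  edge between u and v is the pair of arcs (u,v), (v,u).  The library predicate
  \<^const>\<open>tree\<close> is not the right one for such graphs, because it regards the closed walk u, v, u
  along a single edge as a cycle; undirected cycles are those of length at least 3.
\<close>

definition undirected_tree :: "'a pair_pre_digraph \<Rightarrow> bool" where
  "undirected_tree T \<longleftrightarrow>
     pair_graph T \<and> connected (with_proj T) \<and>
     \<not> (\<exists>p. pre_digraph.cycle (with_proj T) p \<and> 3 \<le> length p)"

definition two_vertex_connected :: "'a pair_pre_digraph \<Rightarrow> bool" where
  "two_vertex_connected G \<longleftrightarrow>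
     connected (with_proj G) \<and>
     (\<forall>v\<in>pverts G. connected (pre_digraph.del_vert (with_proj G) v))"

definition add_edges :: "'a pair_pre_digraph \<Rightarrow> 'a set set \<Rightarrow> 'a pair_pre_digraph" where
  "add_edges G F = \<lparr>pverts = pverts G, parcs = parcs G \<union> {(u, v). {u, v} \<in> F}\<rparr>"

definition del_verts :: "'a pair_pre_digraph \<Rightarrow> 'a set \<Rightarrow> 'a pair_pre_digraph" where
  "del_verts G W =
     \<lparr>pverts = pverts G - W, parcs = {(u, v) \<in> parcs G. u \<notin> W \<and> v \<notin> W}\<rparr>"

text \<open>By symmetry of the arc relation, the out-degree is the degree of the undirected graph.\<close>

abbreviation deg :: "'a pair_pre_digraph \<Rightarrow> 'a \<Rightarrow> nat" where
  "deg G v \<equiv> out_degree (with_proj G) v"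

definition leaves :: "'a pair_pre_digraph \<Rightarrow> 'a set" where
  "leaves G = {v \<in> pverts G. deg G v = 1}"

definition leaves_at :: "'a pair_pre_digraph \<Rightarrow> 'a \<Rightarrow> 'a set" where
  "leaves_at G r = {x \<in> leaves G. (r, x) \<in> parcs G}"

definition representatives :: "'a pair_pre_digraph \<Rightarrow> 'a set" where
  "representatives G = {r \<in> pverts G. 3 \<le> deg G r \<and> leaves_at G r \<noteq> {}}"

definition inner :: "'a list \<Rightarrow> 'a set" where
  "inner p = set (butlast (tl p))"

text \<open>
  Paths are oriented so that they start at an endpoint of degree at least 3; this loses nothing,
  since reversing a path does not change the edge replacing it.  A path consisting of a single
  edge is included, and contracting it changes nothing.
\<close>

definition contractible_path :: "'a pair_pre_digraph \<Rightarrow> 'a list \<Rightarrow> bool" where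
  "contractible_path G p \<longleftrightarrow>
     vpath p (with_proj G) \<and> 2 \<le> length p \<and> (\<forall>w\<in>inner p. deg G w = 2) \<and>
     3 \<le> deg G (hd p) \<and> (3 \<le> deg G (last p) \<or> last p \<in> leaves G)"

text \<open>
  All path-to-edge contractions are performed simultaneously: in a tree, two such paths with
  different sets of endpoints have disjoint interiors, and a contraction does not change the
  degree of any remaining vertex.
\<close>

definition contract :: "'a pair_pre_digraph \<Rightarrow> 'a pair_pre_digraph" where
  "contract G =
     add_edges (del_verts G (\<Union>p\<in>{p. contractible_path G p}. inner p))
       {{hd p, last p} | p. contractible_path G p}"

text \<open>
  Star augmentation is given by its specification only, for a star S of maximum degree
  \<open>\<Delta>\<close>: any choice of \<open>\<Delta> - 1\<close> edges among the leaves that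
  makes the star 2-vertex-connected.
\<close>

definition star_augment :: "'a pair_pre_digraph \<Rightarrow> 'a set set \<Rightarrow> bool" where
  "star_augment S F \<longleftrightarrow>
     F \<subseteq> {e. e \<subseteq> leaves S \<and> card e = 2} \<and>
     card F = Max (deg S ` pverts S) - 1 \<and>
     two_vertex_connected (add_edges S F)"

definition pair_count :: "nat \<Rightarrow> nat \<Rightarrow> nat \<Rightarrow> nat \<Rightarrow> nat" where
  "pair_count d\<^sub>i l\<^sub>i d\<^sub>j l\<^sub>j =
     (if d\<^sub>i - l\<^sub>i = 1 \<and> d\<^sub>j - l\<^sub>j = 1 then l\<^sub>j - 1
      else if d\<^sub>i - l\<^sub>i \<noteq> 1 \<and> d\<^sub>j - l\<^sub>j = 1 then (if min l\<^sub>i l\<^sub>j = l\<^sub>i then l\<^sub>i else l\<^sub>j - 1)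
      else if d\<^sub>i - l\<^sub>i = 1 \<and> d\<^sub>j - l\<^sub>j \<noteq> 1 then l\<^sub>j
      else min l\<^sub>i l\<^sub>j)"

text \<open>
  The algorithm is nondeterministic (ties between representatives, the choice of leaves, star
  augmentation), so it is a relation: \<open>tree_augment T F\<close> says that some terminating run
  on T outputs the edge set F.
\<close>

inductive tree_augment :: "'a pair_pre_digraph \<Rightarrow> 'a set set \<Rightarrow> bool" where
  two_leaves:
    "tree_augment T {{x, y}}"
    if "leaves T = {x, y}" "x \<noteq> y"
| star:
    "tree_augment T F"
    if "card (leaves T) \<noteq> 2"
      "card (representatives (contract T)) = 1"
      "star_augment (contract T) F"
| non_star:
    "tree_augment T ((\<lambda>k. {x k, y k}) ` {1..t} \<union> F)"
    if "card (leaves T) \<noteq> 2"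
      "S = contract T"
      "card (representatives S) \<noteq> 1"
      "is_arg_max (deg S) (\<lambda>r. r \<in> representatives S) r\<^sub>i"
      "is_arg_max (deg S) (\<lambda>r. r \<in> representatives S - {r\<^sub>i}) r\<^sub>j"
      "t = pair_count (deg S r\<^sub>i) (card (leaves_at S r\<^sub>i)) (deg S r\<^sub>j) (card (leaves_at S r\<^sub>j))"
      "inj_on x {1..t}" "x ` {1..t} \<subseteq> leaves_at S r\<^sub>i"
      "inj_on y {1..t}" "y ` {1..t} \<subseteq> leaves_at S r\<^sub>j"
      "tree_augment (del_verts S (x ` {1..t} \<union> y ` {1..t})) F"
    for x y :: "nat \<Rightarrow> 'a" and t :: nat

end

theory Submission
  imports Defs
begin

text \<open>
  Adding the paths \<open>r\<^sub>i, x\<^sub>k, y\<^sub>k, r\<^sub>j\<close> to a 2-connected graph that contains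
  \<open>r\<^sub>i \<noteq> r\<^sub>j\<close> is an ear addition, so it keeps 2-connectivity, and so does subdividing an edge.
  Hence 2-connectivity passes from the reduced tree back to the contracted tree, and, since a
  path-to-edge contraction is undone by repeated subdivision, from there to the original tree.
  The base cases are a path closed to a cycle, which is a subdivision of a single edge, and the
  star, where 2-connectivity is part of the specification.

  For a run to exist, each round must delete at least one pair of leaves and leave a tree; the degrees of
  the two representatives give \<open>0 < t \<le> min l\<^sub>i l\<^sub>j\<close>. If a contracted tree is not a star, removing
  its leaves leaves a tree with at least two leaves, each of which is a representative: it has
  degree at least 3, and only one of its neighbours is not a leaf.

  Trees are handled through the number of their edges rather than through cycles, because
  suppressing a vertex of degree 2 and deleting leaves change this number in an obvious way.
\<close>

section \<open>Connectivity of relations\<close>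

definition del :: "'a set \<Rightarrow> 'a rel \<Rightarrow> 'a rel" where
  "del D E = {(u, v) \<in> E. u \<notin> D \<and> v \<notin> D}"

text \<open>Agrees with connectedness of a digraph when \<open>E\<close> is symmetric and lies
  within \<open>V \<times> V\<close>, see \<open>connected_iff_conn\<close>.\<close>

definition conn :: "'a set \<Rightarrow> 'a rel \<Rightarrow> bool" where
  "conn V E \<longleftrightarrow> V \<noteq> {} \<and> V \<times> V \<subseteq> E\<^sup>*"

text \<open>Taking \<open>D = {}\<close> or \<open>D = {v}\<close> treats connectivity and the deletion of a vertex uniformly.\<close>

definition biconn :: "'a set \<Rightarrow> 'a rel \<Rightarrow> bool" where
  "biconn V E \<longleftrightarrow> (\<forall>v D. D \<subseteq> {v} \<longrightarrow> conn (V - D) (del D E))"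

definition sgraph :: "'a set \<Rightarrow> 'a rel \<Rightarrow> bool" where
  "sgraph V E \<longleftrightarrow> finite V \<and> E \<subseteq> V \<times> V \<and> sym E \<and> irrefl E"

text \<open>An undirected edge is a pair of arcs: \<open>card E\<close> is twice the number of edges.\<close>

definition etree :: "'a set \<Rightarrow> 'a rel \<Rightarrow> bool" where
  "etree V E \<longleftrightarrow> sgraph V E \<and> conn V E \<and> card E + 2 = 2 * card V"

text \<open>
  The result of suppressing the vertices of \<open>W\<close>: restricting the targets under the closure puts
  exactly the internal vertices of the walk in \<open>W\<close>.
\<close>

definition through :: "'a set \<Rightarrow> 'a rel \<Rightarrow> 'a rel" where
  "through W E = {(u, v) \<in> (E \<inter> UNIV \<times> W)\<^sup>* O E. u \<notin> W \<and> v \<notin> W \<and> u \<noteq> v}"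

lemma del_empty [simp]: "del {} E = E"
  by (auto simp: del_def)

lemma sym_del: "sym E \<Longrightarrow> sym (del D E)"
  by (auto simp: del_def sym_def)

lemma del_sgraph: "sgraph V E \<Longrightarrow> sgraph (V - D) (del D E)"
  by (auto simp: sgraph_def del_def sym_def irrefl_def)

lemma sgraph_finite: "sgraph V E \<Longrightarrow> finite E"
  unfolding sgraph_def using finite_subset by blast

lemma conn_mono: "conn V E \<Longrightarrow> E \<subseteq> E'\<^sup>* \<Longrightarrow> conn V E'"
  unfolding conn_def by (metis dual_order.trans rtrancl_subset_rtrancl)

lemma conn_singleton: "conn {v} E"
  by (auto simp: conn_def)

lemma biconn_conn: "biconn V E \<Longrightarrow> conn V E"
  unfolding biconn_def by (metis Diff_empty del_empty empty_subsetI)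

lemma conn_del: "biconn V E \<Longrightarrow> conn (V - {v}) (del {v} E)"
  unfolding biconn_def by blast

lemma biconnI:
  assumes "conn V E" "\<And>v. v \<in> V \<Longrightarrow> conn (V - {v}) (del {v} E)" "E \<subseteq> V \<times> V"
  shows "biconn V E"
  unfolding biconn_def
proof (intro allI impI)
  fix v and D :: "'a set" assume "D \<subseteq> {v}"
  then consider "D = {}" | "D = {v}" by blast
  then show "conn (V - D) (del D E)"
  proof cases
    case 2
    \<comment> \<open>\<open>biconn\<close> ranges over all \<open>v\<close>; deleting an outside
      vertex changes nothing.\<close>
    have "v \<notin> V \<Longrightarrow> V - {v} = V \<and> del {v} E = E"
      using assms(3) by (auto simp: del_def)
    then show ?thesis using assms(1,2) 2 by metis
  qed (use assms(1) in simp)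
qed

text \<open>Any two vertices are joined by going into \<open>U\<close>, along the walk in
  \<open>H\<close> there, each arc of which is a walk in \<open>E\<close>, and out again. All later
  extensions by new vertices reduce to this.\<close>

lemma conn_extend:
  assumes "conn U H" "H \<subseteq> E\<^sup>*" "sym E" "U \<subseteq> V"
    and "\<And>z. z \<in> V - U \<Longrightarrow> \<exists>u\<in>U. (z, u) \<in> E\<^sup>*"
  shows "conn V E"
  unfolding conn_def
proof (intro conjI subsetI)
  show "V \<noteq> {}" using assms(1,4) by (auto simp: conn_def)
  fix p assume "p \<in> V \<times> V"
  then obtain a b where p: "p = (a, b)" "a \<in> V" "b \<in> V" by blast
  have *: "\<exists>u\<in>U. (z, u) \<in> E\<^sup>*" if "z \<in> V" for z
    using assms(5)[of z] that by blast
  obtain u v where uv: "u \<in> U" "v \<in> U" "(a, u) \<in> E\<^sup>*" "(b, v) \<in> E\<^sup>*"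
    using *[OF p(2)] *[OF p(3)] by blast
  have "(u, v) \<in> H\<^sup>*" using assms(1) uv by (auto simp: conn_def)
  then have "(u, v) \<in> E\<^sup>*" using assms(2) by (metis rtrancl_subset_rtrancl subsetD)
  moreover have "(v, b) \<in> E\<^sup>*" using uv(4) assms(3) by (metis symD sym_rtrancl)
  ultimately show "p \<in> E\<^sup>*" using uv(3) p(1) by (meson rtrancl_trans)
qed

text \<open>
  If \<open>U = {a, b}\<close>, subdividing the only edge would give a path; hence the hypothesis on
  \<open>card U\<close>.
\<close>

lemma biconn_subdivide:
  assumes "biconn U H" "H \<subseteq> U \<times> U" "H \<subseteq> E \<union> {(a, b), (b, a)}"
    and "sym E" "w \<notin> U" "a \<in> U" "b \<in> U" "a \<noteq> b" "(a, w) \<in> E" "(w, b) \<in> E"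
    and "3 \<le> card U \<or> (a, b) \<in> E"
    and E: "E \<subseteq> insert w U \<times> insert w U"
  shows "biconn (insert w U) E"
  unfolding biconn_def
proof (intro allI impI)
  fix v and D :: "'a set" assume D: "D \<subseteq> {v}"
  have S: "sym (del D E)" using assms(4) by (rule sym_del)
  have cD: "conn (U - D) (del D H)" using assms(1) D unfolding biconn_def by blast
  have wa: "(w, a) \<in> E" using assms(4,9) by (auto dest: symD)
  have bw: "(b, w) \<in> E" using assms(4,10) by (auto dest: symD)
  show "conn (insert w U - D) (del D E)"
  proof (cases "w \<in> D")
    case False
    \<comment> \<open>Only arcs of \<open>H\<close> between \<open>a\<close> and \<open>b\<close>
      can be missing in \<open>E\<close>; the detour through \<open>w\<close> replaces them.\<close>
    have "del D H \<subseteq> (del D E)\<^sup>*"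
    proof (rule subrelI)
      fix x y assume xy: "(x, y) \<in> del D H"
      then consider "(x, y) \<in> E" | "x = a" "y = b" | "x = b" "y = a"
        using assms(3) by (auto simp: del_def)
      then show "(x, y) \<in> (del D E)\<^sup>*"
      proof cases
        case 1 then show ?thesis using xy by (auto simp: del_def)
      next
        case 2
        then have "(x, w) \<in> del D E" "(w, y) \<in> del D E"
          using False xy assms(9,10) by (auto simp: del_def)
        then show ?thesis by (meson converse_rtrancl_into_rtrancl r_into_rtrancl)
      next
        case 3
        then have "(x, w) \<in> del D E" "(w, y) \<in> del D E"
          using False xy wa bw by (auto simp: del_def)
        then show ?thesis by (meson converse_rtrancl_into_rtrancl r_into_rtrancl)
      qed
    qed
    moreover have "\<exists>u\<in>U - D. (z, u) \<in> (del D E)\<^sup>*" if "z \<in> insert w U - D - (U - D)" for z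
    proof -
      have "z = w" using that by blast
      \<comment> \<open>\<open>D\<close> has at most one element, so one of the neighbours
        \<open>a\<close>, \<open>b\<close> of \<open>w\<close> survives.\<close>
      moreover have "(w, a) \<in> del D E \<and> a \<in> U - D \<or> (w, b) \<in> del D E \<and> b \<in> U - D"
        using False D assms(6-10) wa by (auto simp: del_def)
      ultimately show ?thesis by blast
    qed
    ultimately show ?thesis
      using conn_extend[OF cD _ S, of "insert w U - D"] by blast
  next
    case True
    then have Dw: "D = {w}" using D by blast
    have ab: "(a, b) \<in> (del D E)\<^sup>*"
    proof (cases "(a, b) \<in> E")
      case True
      then show ?thesis using Dw assms(5-7) by (auto simp: del_def)
    next
      case False
      then have "3 \<le> card U" using assms(11) by blast
      then have "\<not> U \<subseteq> {a, b}"
        by (metis assms(8) card_2_iff card_mono finite.emptyI finite.insertI not_less_eq_eq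
            numeral_2_eq_2 numeral_3_eq_3)
      then obtain c where c: "c \<in> U" "c \<noteq> a" "c \<noteq> b" by blast
      \<comment> \<open>With \<open>w\<close> deleted, the arc between \<open>a\<close> and
        \<open>b\<close> must be bypassed. A walk from \<open>a\<close> to \<open>c\<close> avoiding
        \<open>b\<close>, followed by one from \<open>c\<close> to \<open>b\<close> avoiding
        \<open>a\<close>, never uses that arc.\<close>
      have "(a, c) \<in> (del {b} H)\<^sup>*"
        using conn_del[OF assms(1), of b] c assms(6,8) unfolding conn_def by blast
      moreover have "(c, b) \<in> (del {a} H)\<^sup>*"
        using conn_del[OF assms(1), of a] c assms(7,8) unfolding conn_def by blast
      moreover have "del {b} H \<subseteq> del D E" "del {a} H \<subseteq> del D E"
        using assms(2,3,5) Dw by (auto simp: del_def)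
      ultimately show ?thesis by (meson rtrancl_mono rtrancl_trans subsetD)
    qed
    then have ba: "(b, a) \<in> (del D E)\<^sup>*" using S by (metis symD sym_rtrancl)
    have "H \<subseteq> (del D E)\<^sup>*"
    proof (rule subrelI)
      fix x y assume xy: "(x, y) \<in> H"
      then consider "(x, y) \<in> E" | "x = a" "y = b" | "x = b" "y = a"
        using assms(3) by auto
      then show "(x, y) \<in> (del D E)\<^sup>*"
        by cases (use ab ba xy Dw assms(2,5) in \<open>auto simp: del_def\<close>)
    qed
    then have "conn U (del D E)" using conn_mono[OF biconn_conn[OF assms(1)]] by blast
    then show ?thesis using Dw assms(5) by simp
  qed
qed

text \<open>General form of ear addition: old vertices stay connected inside \<open>H\<close>, so it
  is enough that each new vertex, after any deletion, still reaches a surviving old one.\<close>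

lemma biconn_attach:
  assumes "biconn U H" "H \<subseteq> E" "sym E" "U \<subseteq> V"
    and "\<And>D v z. D \<subseteq> {v} \<Longrightarrow> z \<in> V - U \<Longrightarrow> z \<notin> D \<Longrightarrow> \<exists>u\<in>U - D. (z, u) \<in> (del D E)\<^sup>*"
  shows "biconn V E"
  unfolding biconn_def
proof (intro allI impI)
  fix v and D :: "'a set" assume D: "D \<subseteq> {v}"
  then have c: "conn (U - D) (del D H)" using assms(1) unfolding biconn_def by blast
  have d: "del D H \<subseteq> (del D E)\<^sup>*" using assms(2) by (auto simp: del_def)
  show "conn (V - D) (del D E)"
    by (rule conn_extend[OF c d sym_del[OF assms(3)]]) (use D assms(4,5) in auto)
qed

section \<open>Trees and vertices of degree 2\<close>

text \<open>A subtree is grown by one crossing edge at a time until it covers \<open>V\<close>. This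
  gives both the lower bound on the number of edges of a connected graph and the passage from
  acyclicity to the edge count.\<close>

lemma spanning_etree:
  assumes "sgraph V E" "conn V E"
  shows "\<exists>H\<subseteq>E. etree V H"
proof -
  have fin: "finite V" using assms(1) by (simp add: sgraph_def)
  have "\<exists>W H. W \<subseteq> V \<and> card W = Suc k \<and> H \<subseteq> E \<and> etree W H" if "k < card V" for k
    using that
  proof (induction k)
    case 0
    obtain v where "v \<in> V" using assms(2) by (auto simp: conn_def)
    then show ?case
      by (intro exI[of _ "{v}"] exI[of _ "{}"]) (auto simp: etree_def sgraph_def conn_def sym_def irrefl_def)
  next
    case (Suc k)
    then obtain W H where WH: "W \<subseteq> V" "card W = Suc k" "H \<subseteq> E" "etree W H" by auto
    \<comment> \<open>Without a crossing edge \<open>W\<close> would be closed under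
      \<open>E\<close>, so connectedness would force \<open>W = V\<close>, against the
      cardinality.\<close>
    have "\<exists>x y. x \<in> W \<and> y \<in> V - W \<and> (x, y) \<in> E"
    proof (rule ccontr)
      assume n: "\<not> ?thesis"
      obtain a where a: "a \<in> W" using WH(2) by fastforce
      have "y \<in> W" if "(a, y) \<in> E\<^sup>*" for y
        using that
      proof induction
        case (step y z)
        then show ?case using n assms(1) unfolding sgraph_def by blast
      qed (rule a)
      then have "V \<subseteq> W" using a WH(1) assms(2) unfolding conn_def by blast
      then show False using WH(1,2) Suc.prems by (metis less_irrefl subset_antisym)
    qed
    then obtain x y where xy: "x \<in> W" "y \<in> V - W" "(x, y) \<in> E" by blast
    let ?H = "H \<union> {(x, y), (y, x)}"
    have finW: "finite W" using WH(1) fin by (rule finite_subset)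
    have H: "sgraph W H" "conn W H" "card H + 2 = 2 * card W"
      using WH(4) by (auto simp: etree_def)
    have sg: "sgraph (insert y W) ?H"
      using H(1) xy by (auto simp: sgraph_def sym_def irrefl_def)
    have "conn (insert y W) ?H"
      by (rule conn_extend[OF H(2)]) (use sg xy in \<open>auto simp: sgraph_def\<close>)
    moreover have "card ?H + 2 = 2 * card (insert y W)"
    proof -
      have "(x, y) \<notin> H" "(y, x) \<notin> H" "x \<noteq> y" using H(1) xy by (auto simp: sgraph_def)
      then show ?thesis using H(3) xy finW sgraph_finite[OF H(1)] by simp
    qed
    moreover have "?H \<subseteq> E" using WH(3) xy(3) assms(1) by (auto simp: sgraph_def dest: symD)
    moreover have "insert y W \<subseteq> V" "card (insert y W) = Suc (Suc k)"
      using WH(1,2) xy(2) finW by auto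
    ultimately show ?case using sg unfolding etree_def by blast
  qed
  moreover have "card V \<noteq> 0" using assms fin by (simp add: conn_def)
  ultimately obtain W H where WH: "W \<subseteq> V" "card W = card V" "H \<subseteq> E" "etree W H"
    by (metis Suc_pred lessI not_gr_zero)
  then have "W = V" using fin by (metis card_subset_eq)
  then show ?thesis using WH by blast
qed

lemma conn_card_le:
  assumes "sgraph V E" "conn V E"
  shows "2 * card V \<le> card E + 2"
  using spanning_etree[OF assms] sgraph_finite[OF assms(1)]
  by (metis add.commute card_mono etree_def nat_add_left_cancel_le)

section \<open>Suppression of vertices of degree 2 and its reversal\<close>

lemma through_empty: "irrefl E \<Longrightarrow> through {} E = E"
  by (auto simp: through_def irrefl_def)

text \<open>Allows sets of vertices to be suppressed one vertex at a time, by induction on the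
  set.\<close>

lemma through_through:
  assumes "w \<notin> W"
  shows "through {w} (through W E) = through (insert w W) E" (is "?L = ?R")
proof
  let ?A = "E \<inter> UNIV \<times> W" and ?B = "E \<inter> UNIV \<times> insert w W"
  show "?L \<subseteq> ?R"
  proof (rule subrelI)
    fix u v assume uv: "(u, v) \<in> ?L"
    have AB: "?A\<^sup>* \<subseteq> ?B\<^sup>*" by (rule rtrancl_mono) blast
    have T: "through W E \<inter> UNIV \<times> {w} \<subseteq> ?B\<^sup>*"
    proof (rule subrelI)
      fix a b assume "(a, b) \<in> through W E \<inter> UNIV \<times> {w}"
      then obtain c where "(a, c) \<in> ?A\<^sup>*" "(c, w) \<in> E" "b = w" by (auto simp: through_def)
      moreover from this have "(c, b) \<in> ?B" by blast
      ultimately show "(a, b) \<in> ?B\<^sup>*" using AB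
        by (meson rtrancl.rtrancl_into_rtrancl subsetD)
    qed
    obtain c where c: "(u, c) \<in> (through W E \<inter> UNIV \<times> {w})\<^sup>*"
      and v: "u \<noteq> w" "v \<noteq> w" "u \<noteq> v" "(c, v) \<in> through W E"
      using uv unfolding through_def[of "{w}"] by blast
    then obtain d where "(c, d) \<in> ?A\<^sup>*" "(d, v) \<in> E" and vW: "v \<notin> W"
      unfolding through_def by blast
    then have "(u, c) \<in> ?B\<^sup>*" "(c, d) \<in> ?B\<^sup>*"
      using c AB T by (meson rtrancl_subset_rtrancl subsetD)+
    moreover have "u \<notin> W"
    proof (cases "u = c")
      case False
      then obtain e where "(u, e) \<in> through W E"
        using \<open>(u, c) \<in> (through W E \<inter> UNIV \<times> {w})\<^sup>*\<close> by (meson IntE converse_rtranclE)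
      then show ?thesis by (auto simp: through_def)
    qed (use v(4) in \<open>auto simp: through_def\<close>)
    ultimately show "(u, v) \<in> ?R"
      using v vW \<open>(d, v) \<in> E\<close> unfolding through_def by (auto intro: rtrancl_trans)
  qed
  show "?R \<subseteq> ?L"
  proof (rule subrelI)
    fix u v assume "(u, v) \<in> ?R"
    then obtain z where z: "(u, z) \<in> ?B\<^sup>*" "(z, v) \<in> E" and
      uv: "u \<noteq> w" "v \<noteq> w" "u \<notin> W" "v \<notin> W" "u \<noteq> v" by (auto simp: through_def)
    \<comment> \<open>The walk is cut at its last visit to \<open>w\<close>: what precedes it is a
      single arc of \<open>through W E\<close>, what follows stays in \<open>W\<close>.\<close>
    have "(u, z) \<in> ?A\<^sup>* \<or> (u, w) \<in> through W E \<and> (w, z) \<in> ?A\<^sup>*"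
      using z(1)
    proof induction
      case (step y z)
      show ?case
      proof (cases "z = w")
        case True
        then show ?thesis using step uv assms unfolding through_def by blast
      next
        case False
        then have "(y, z) \<in> ?A" using step(2) by blast
        then show ?thesis using step(3) by (meson rtrancl.rtrancl_into_rtrancl)
      qed
    qed simp
    then show "(u, v) \<in> ?L"
    proof
      assume "(u, z) \<in> ?A\<^sup>*"
      then have "(u, v) \<in> through W E" using z(2) uv by (auto simp: through_def)
      then show ?thesis using uv unfolding through_def[of "{w}"] by blast
    next
      assume *: "(u, w) \<in> through W E \<and> (w, z) \<in> ?A\<^sup>*"
      then have "(w, v) \<in> through W E" using z(2) uv assms by (auto simp: through_def)
      then show ?thesis using * uv unfolding through_def[of "{w}"] by blast
    qed
  qed
qed

text \<open>Since \<open>E\<close> is irreflexive, a walk whose internal vertices all equal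
  \<open>w\<close> visits \<open>w\<close> at most once.\<close>

lemma through_sub:
  "irrefl E \<Longrightarrow> E \<subseteq> V \<times> V \<Longrightarrow> w \<in> V \<Longrightarrow>
   through {w} E = del {w} E \<union> {(a, b). a \<noteq> b \<and> (a, w) \<in> E \<and> (w, b) \<in> E}"
proof -
  assume irr: "irrefl E"
  have "(u, z) \<in> (E \<inter> UNIV \<times> {w})\<^sup>* \<Longrightarrow> u = z \<or> (u, w) \<in> E \<and> z = w" for u z
    by (induction rule: rtrancl_induct) (use irr in \<open>auto simp: irrefl_def\<close>)
  moreover have "(a, w) \<in> E \<Longrightarrow> (a, w) \<in> (E \<inter> UNIV \<times> {w})\<^sup>*" for a by blast
  ultimately show ?thesis using irr unfolding through_def del_def irrefl_def by blast
qed

text \<open>The two edges at \<open>w\<close> are replaced by one new edge, so vertices and edges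
  both decrease by one. That the edge is new also keeps the degrees: at \<open>a\<close> the
  neighbour \<open>w\<close> is exchanged for \<open>b\<close>, and vice versa.\<close>

lemma etree_suppress:
  assumes "etree V E" "w \<in> V" "E `` {w} = {a, b}" "a \<noteq> b"
  shows "etree (V - {w}) (through {w} E)"
    and "through {w} E = del {w} E \<union> {(a, b), (b, a)}"
    and "(a, b) \<notin> E"
    and "\<And>v. v \<noteq> w \<Longrightarrow> card (through {w} E `` {v}) = card (E `` {v})"
proof -
  have sg: "sgraph V E" and con: "conn V E" and cE: "card E + 2 = 2 * card V"
    using assms(1) by (auto simp: etree_def)
  have fV: "finite V" and EV: "E \<subseteq> V \<times> V" and sym: "sym E" and irr: "irrefl E"
    using sg by (auto simp: sgraph_def)
  have fE: "finite E" using sg by (rule sgraph_finite)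
  have wE: "(w, x) \<in> E \<longleftrightarrow> x = a \<or> x = b" for x using assms(3) by auto
  have Ew: "(x, w) \<in> E \<longleftrightarrow> x = a \<or> x = b" for x using wE[of x] sym by (metis symD)
  have ne: "a \<noteq> w" "b \<noteq> w" and abV: "a \<in> V" "b \<in> V" using wE irr EV by (auto simp: irrefl_def)
  show eq: "through {w} E = del {w} E \<union> {(a, b), (b, a)}"
    unfolding through_sub[OF irr EV assms(2)] using assms(4) wE Ew by auto
  have sgT: "sgraph (V - {w}) (through {w} E)"
    unfolding eq using del_sgraph[OF sg, of "{w}"] ne abV assms(4)
    by (auto simp: sgraph_def sym_def irrefl_def)
  have conT: "conn (V - {w}) (through {w} E)"
  proof -
    \<comment> \<open>A walk of \<open>E\<close> is followed in the suppressed graph; while it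
      stands at \<open>w\<close>, its image waits at \<open>a\<close>, which is adjacent to
      \<open>b\<close>.\<close>
    have *: "if y = w then (x, a) \<in> (through {w} E)\<^sup>* else (x, y) \<in> (through {w} E)\<^sup>*"
      if "(x, y) \<in> E\<^sup>*" "x \<noteq> w" for x y
      using that
    proof induction
      case (step y z)
      have ab: "(a, b) \<in> through {w} E" "(b, a) \<in> through {w} E" using eq by auto
      consider "y = w" | "y \<noteq> w" "z = w" | "y \<noteq> w" "z \<noteq> w" by blast
      then show ?case
      proof cases
        case 1
        then have "z = a \<or> z = b" "(x, a) \<in> (through {w} E)\<^sup>*" "z \<noteq> w" using step wE ne by auto
        then show ?thesis using ab by (auto intro: rtrancl_into_rtrancl)
      next
        case 2
        then have "y = a \<or> y = b" "(x, y) \<in> (through {w} E)\<^sup>*" using step Ew by auto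
        then show ?thesis using ab 2 by (auto intro: rtrancl_into_rtrancl)
      next
        case 3
        then have "(y, z) \<in> through {w} E" using step(2) eq by (auto simp: del_def)
        then show ?thesis using 3 step by (auto intro: rtrancl_into_rtrancl)
      qed
    qed simp
    have "(x, y) \<in> (through {w} E)\<^sup>*" if "x \<in> V - {w}" "y \<in> V - {w}" for x y
    proof -
      have "(x, y) \<in> E\<^sup>*" using con that unfolding conn_def by blast
      then show ?thesis using *[of x y] that by simp
    qed
    then show ?thesis using ne abV by (auto simp: conn_def)
  qed
  let ?N = "{(a, w), (w, a), (b, w), (w, b)}"
  have dE: "del {w} E = E - ?N" using wE Ew by (auto simp: del_def)
  have NE: "?N \<subseteq> E" using wE Ew by auto
  have cN: "card ?N = 4" using ne assms(4) by auto
  have cd: "card (del {w} E) + 4 = card E"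
    unfolding dE using card_Diff_subset[of ?N E] card_mono[OF fE NE] NE cN by auto
  have cV: "card (V - {w}) + 1 = card V" using assms(2) fV
    by (metis Suc_eq_plus1 card_Suc_Diff1)
  \<comment> \<open>This replaces the acyclicity argument: in a triangle \<open>a\<close>,
    \<open>w\<close>, \<open>b\<close>, suppression would remove two edges with one vertex and leave
    a connected graph with fewer edges than \<open>conn_card_le\<close> permits.\<close>
  show nab: "(a, b) \<notin> E"
  proof
    assume "(a, b) \<in> E"
    then have "through {w} E = del {w} E"
      using eq sym ne by (auto simp: del_def dest: symD)
    then show False using conn_card_le[OF sgT conT] cd cV cE by simp
  qed
  have "(a, b) \<notin> del {w} E" "(b, a) \<notin> del {w} E"
    using nab sym by (auto simp: del_def dest: symD)
  then have "card (through {w} E) = card (del {w} E) + 2"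
    unfolding eq using assms(4) fE by (simp add: dE)
  then show "etree (V - {w}) (through {w} E)"
    using sgT conT cd cE cV unfolding etree_def by simp
  show "card (through {w} E `` {v}) = card (E `` {v})" if "v \<noteq> w" for v
  proof -
    have fin: "finite (E `` {v})" for v using fE by (rule finite_Image)
    have nba: "(b, a) \<notin> E" using nab sym by (meson symD)
    consider "v = a" | "v = b" | "v \<noteq> a" "v \<noteq> b" by blast
    then show ?thesis
    proof cases
      case 1
      have "through {w} E `` {v} = insert b (E `` {v} - {w})"
        unfolding eq using 1 ne assms(4) by (auto simp: del_def)
      moreover have "b \<notin> E `` {v}" "w \<in> E `` {v}" using 1 nab Ew by auto
      ultimately show ?thesis using fin[of v] by (metis Diff_iff card.remove card_insert_disjoint finite_Diff)
    next
      case 2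
      have "through {w} E `` {v} = insert a (E `` {v} - {w})"
        unfolding eq using 2 ne assms(4) by (auto simp: del_def)
      moreover have "a \<notin> E `` {v}" "w \<in> E `` {v}" using 2 nba Ew by auto
      ultimately show ?thesis using fin[of v] by (metis Diff_iff card.remove card_insert_disjoint finite_Diff)
    next
      case 3
      have "through {w} E `` {v} = E `` {v}"
        unfolding eq using 3 that Ew by (auto simp: del_def)
      then show ?thesis by simp
    qed
  qed
qed

lemma deg2_nbrs:
  assumes "card (E `` {w}) = 2"
  obtains a b where "E `` {w} = {a, b}" "a \<noteq> b"
  using assms by (meson card_2_iff)

text \<open>Induction on \<open>W\<close>; as each suppression preserves all other degrees, the
  vertices still to come keep degree 2.\<close>

lemma etree_through:
  assumes "etree V E" "W \<subseteq> {v \<in> V. card (E `` {v}) = 2}"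
  shows "etree (V - W) (through W E)"
    and "\<forall>v\<in>V - W. card (through W E `` {v}) = card (E `` {v})"
proof -
  have "finite V" using assms(1) by (simp add: etree_def sgraph_def)
  then have "finite W" using assms(2) finite_subset by fastforce
  then have "etree (V - W) (through W E) \<and>
      (\<forall>v\<in>V - W. card (through W E `` {v}) = card (E `` {v}))"
    using assms(2)
  proof induction
    case empty
    then show ?case using assms(1) by (auto simp: through_empty etree_def sgraph_def)
  next
    case (insert w W)
    have w: "w \<in> V - W" "card (E `` {w}) = 2" using insert by auto
    have IH: "etree (V - W) (through W E)"
      "\<forall>v\<in>V - W. card (through W E `` {v}) = card (E `` {v})" using insert by auto
    then have "card (through W E `` {w}) = 2" using w by simp
    then obtain a b where ab: "through W E `` {w} = {a, b}" "a \<noteq> b" by (rule deg2_nbrs)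
    note s = etree_suppress[OF IH(1) w(1) ab, unfolded through_through[OF insert(2)]]
    have "V - W - {w} = V - insert w W" by blast
    then show ?case using s(1) s(4) IH(2) by auto
  qed
  then show "etree (V - W) (through W E)"
    and "\<forall>v\<in>V - W. card (through W E `` {v}) = card (E `` {v})" by blast+
qed

text \<open>The vertices of \<open>W\<close> are put back one by one through
  \<open>biconn_subdivide\<close>. The last assumption serves the first of these subdivisions;
  afterwards the new vertex and its two neighbours make up the three vertices required.\<close>

lemma biconn_through:
  assumes "etree V E" "W \<subseteq> {v \<in> V. card (E `` {v}) = 2}"
    and "F \<subseteq> (V - W) \<times> (V - W)" "sym F" "biconn (V - W) (through W E \<union> F)"
    and "3 \<le> card (V - W) \<or> (\<forall>x\<in>V - W. \<forall>y\<in>V - W. x \<noteq> y \<longrightarrow> (x, y) \<in> F)"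
  shows "biconn V (E \<union> F)"
proof -
  have finV: "finite V" using assms(1) by (simp add: etree_def sgraph_def)
  then have "finite W" using assms(2) finite_subset by fastforce
  then show ?thesis using assms(2,3,5,6)
  proof induction
    case empty
    then show ?case using assms(1) by (auto simp: through_empty etree_def sgraph_def)
  next
    case (insert w W)
    have w: "w \<in> V - W" "card (E `` {w}) = 2" and W: "W \<subseteq> {v \<in> V. card (E `` {v}) = 2}"
      using insert by auto
    note t = etree_through[OF assms(1) W]
    then have "card (through W E `` {w}) = 2" using w by simp
    then obtain a b where ab: "through W E `` {w} = {a, b}" "a \<noteq> b" by (rule deg2_nbrs)
    note s = etree_suppress[OF t(1) w(1) ab]
    have sg: "through W E \<subseteq> (V - W) \<times> (V - W)" "sym (through W E)" "irrefl (through W E)"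
      using t(1) by (auto simp: etree_def sgraph_def)
    let ?U = "V - insert w W"
    have V: "insert w ?U = V - W" using w by blast
    have abU: "a \<in> ?U" "b \<in> ?U" using ab(1) sg(1,3) by (auto simp: irrefl_def)
    have sgt: "through {w} (through W E) \<subseteq> ?U \<times> ?U"
      using s(1) by (auto simp: etree_def sgraph_def)
    have "biconn (insert w ?U) (through W E \<union> F)"
    proof (rule biconn_subdivide[where H = "through {w} (through W E) \<union> F" and a = a and b = b])
      show "biconn ?U (through {w} (through W E) \<union> F)"
        using insert.prems(3) through_through[OF insert.hyps(2)] by simp
      show "through {w} (through W E) \<union> F \<subseteq> ?U \<times> ?U"
        using sgt insert.prems(2) by blast
      show "through {w} (through W E) \<union> F \<subseteq> through W E \<union> F \<union> {(a, b), (b, a)}"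
        unfolding s(2) by (auto simp: del_def)
      show "sym (through W E \<union> F)" using sg(2) assms(4) by (rule sym_Un)
      show "(a, w) \<in> through W E \<union> F" "(w, b) \<in> through W E \<union> F"
        using ab(1) sg(2) by (auto dest: symD)
      show "3 \<le> card ?U \<or> (a, b) \<in> through W E \<union> F"
        using insert.prems(4) abU ab(2) by blast
      show "through W E \<union> F \<subseteq> insert w ?U \<times> insert w ?U"
        using sg(1) insert.prems(2) V by blast
    qed (use abU ab(2) in auto)
    moreover have "3 \<le> card (V - W)"
    proof -
      have "card {a, b, w} = 3" using ab(2) abU by auto
      moreover have "{a, b, w} \<subseteq> V - W" using abU w(1) by blast
      ultimately show ?thesis by (metis card_mono finV finite_Diff)
    qed
    moreover have "F \<subseteq> (V - W) \<times> (V - W)" using insert.prems(2) by blast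
    ultimately show ?case using insert.IH W V by simp
  qed
qed

section \<open>Leaves of trees\<close>

definition lf :: "'a set \<Rightarrow> 'a rel \<Rightarrow> 'a set" where
  "lf V E = {v \<in> V. card (E `` {v}) = 1}"

lemma conn_closed:
  assumes "conn V E" "E `` A \<subseteq> A" "a \<in> A" "a \<in> V"
  shows "V \<subseteq> A"
proof
  fix x assume "x \<in> V"
  then have "(a, x) \<in> E\<^sup>*" using assms(1,4) by (auto simp: conn_def)
  then show "x \<in> A" by induction (use assms in auto)
qed

lemma sgraph_Image_finite: "sgraph V E \<Longrightarrow> finite (E `` A)"
  by (rule finite_Image[OF sgraph_finite])

lemma deg_pos:
  assumes "sgraph V E" "conn V E" "2 \<le> card V" "v \<in> V"
  shows "1 \<le> card (E `` {v})"
proof (rule ccontr)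
  assume "\<not> 1 \<le> card (E `` {v})"
  then have "E `` {v} = {}" using sgraph_Image_finite[OF assms(1)] by (simp add: not_le)
  then have "V \<subseteq> {v}" using conn_closed[OF assms(2), of "{v}" v] assms(4) by auto
  then have "card V \<le> 1"
    by (metis card.empty card_insert_disjoint card_mono empty_iff finite.emptyI finite.insertI One_nat_def)
  then show False using assms(3) by simp
qed

lemma leaf_nbr:
  assumes "v \<in> lf V E"
  obtains n where "(v, n) \<in> E" "\<And>y. (v, y) \<in> E \<Longrightarrow> y = n"
proof -
  obtain n where "E `` {v} = {n}" using assms by (auto simp: lf_def card_1_singleton_iff)
  then show thesis using that by (metis Image_singleton_iff singletonD singletonI)
qed

text \<open>The truncated difference counts leaves, of degree 1, as 0 instead of -1.\<close>

lemma card_leaves: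
  assumes "etree V E" "2 \<le> card V"
  shows "card (lf V E) = 2 + (\<Sum>v\<in>V. card (E `` {v}) - 2)"
proof -
  have sg: "sgraph V E" and con: "conn V E" and cE: "card E + 2 = 2 * card V"
    using assms(1) by (auto simp: etree_def)
  have fV: "finite V" and EV: "E \<subseteq> V \<times> V" using sg by (auto simp: sgraph_def)
  have "E = Sigma V (\<lambda>v. E `` {v})" using EV by auto
  then have "card E = (\<Sum>v\<in>V. card (E `` {v}))"
    using card_SigmaI[OF fV, of "\<lambda>v. E `` {v}"] sgraph_Image_finite[OF sg] by metis
  moreover have "card (lf V E) = (\<Sum>v\<in>V. if card (E `` {v}) = 1 then 1 else 0)"
    unfolding lf_def using fV by (simp add: sum.If_cases Int_def)
  \<comment> \<open>The identity holds termwise: at a leaf the indicator supplies the missing 1. It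
    would fail at degree 0, which \<open>deg_pos\<close> excludes.\<close>
  moreover have "(\<Sum>v\<in>V. card (E `` {v})) + (\<Sum>v\<in>V. if card (E `` {v}) = 1 then 1 else 0)
      = (\<Sum>v\<in>V. 2) + (\<Sum>v\<in>V. card (E `` {v}) - 2)"
    unfolding sum.distrib[symmetric]
  proof (rule sum.cong)
    fix v assume "v \<in> V"
    then show "card (E `` {v}) + (if card (E `` {v}) = 1 then 1 else 0) = 2 + (card (E `` {v}) - 2)"
      using deg_pos[OF sg con assms(2), of v] by (cases "card (E `` {v}) = 1") simp_all
  qed simp
  ultimately show ?thesis using cE by simp
qed

text \<open>The sum in \<open>card_leaves\<close> vanishes exactly in this case. Thus the two-leaf
  test of the algorithm recognises paths, and its failure provides a branch vertex.\<close>

lemma card_leaves_2_iff: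
  assumes "etree V E" "2 \<le> card V"
  shows "card (lf V E) = 2 \<longleftrightarrow> (\<forall>v\<in>V. card (E `` {v}) \<le> 2)"
proof -
  have "finite V" using assms(1) by (auto simp: etree_def sgraph_def)
  then show ?thesis unfolding card_leaves[OF assms] by simp
qed

text \<open>Each is the only neighbour of the other, so the pair is closed under adjacency.\<close>

lemma adjacent_leaves:
  assumes "sgraph V E" "conn V E" "(x, y) \<in> E" "x \<in> lf V E" "y \<in> lf V E"
  shows "V \<subseteq> {x, y}"
proof -
  have "(y, x) \<in> E" using assms(1,3) by (auto simp: sgraph_def dest: symD)
  then have "\<And>z. (x, z) \<in> E \<Longrightarrow> z = y" "\<And>z. (y, z) \<in> E \<Longrightarrow> z = x"
    using assms(3-5) by (metis leaf_nbr)+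
  then have "E `` {x, y} \<subseteq> {x, y}" by auto
  then show ?thesis using conn_closed[OF assms(2), of "{x, y}" x] assms(4) by (auto simp: lf_def)
qed

text \<open>Every deleted leaf takes exactly one edge with it, and no edge is counted twice because
  no two deleted leaves are adjacent.\<close>

lemma etree_del_leaves:
  assumes "etree V E" "X \<subseteq> lf V E" "\<And>x y. x \<in> X \<Longrightarrow> (x, y) \<in> E \<Longrightarrow> y \<notin> X"
  shows "etree (V - X) (del X E)"
proof -
  have sg: "sgraph V E" and con: "conn V E" and cE: "card E + 2 = 2 * card V"
    using assms(1) by (auto simp: etree_def)
  have fV: "finite V" and EV: "E \<subseteq> V \<times> V" and sym: "sym E" using sg by (auto simp: sgraph_def)
  have XV: "X \<subseteq> V" using assms(2) by (auto simp: lf_def)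
  have fX: "finite X" using XV fV by (rule finite_subset)
  \<comment> \<open>At a deleted leaf the invariant speaks about its neighbours: the walk can only
    return to the vertex it came from, so the excursion is cut out.\<close>
  have reach: "if z \<in> X then \<forall>y. (y, z) \<in> E \<longrightarrow> (u, y) \<in> (del X E)\<^sup>* else (u, z) \<in> (del X E)\<^sup>*"
    if "(u, z) \<in> E\<^sup>*" "u \<notin> X" for u z
    using that
  proof induction
    case (step y z)
    have zy: "(z, y) \<in> E" using step(2) sym by (metis symD)
    consider "y \<in> X" "z \<notin> X" | "y \<notin> X" "z \<in> X" | "y \<notin> X" "z \<notin> X"
      using assms(3) step(2) by blast
    then show ?case
    proof cases
      case 1
      then show ?thesis using step zy by simp
    next
      case 2
      have "y' = y" if "(y', z) \<in> E" for y'
      proof -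
        have "(z, y') \<in> E" using that sym by (metis symD)
        moreover obtain n where "\<And>y. (z, y) \<in> E \<Longrightarrow> y = n"
          using leaf_nbr 2 assms(2) by (metis subsetD)
        ultimately show ?thesis using zy by metis
      qed
      moreover have "(u, y) \<in> (del X E)\<^sup>*" using 2 step(3,4) by simp
      ultimately show ?thesis using 2 by metis
    next
      case 3
      then have "(y, z) \<in> del X E" using step(2) by (auto simp: del_def)
      moreover have "(u, y) \<in> (del X E)\<^sup>*" using 3 step(3,4) by simp
      ultimately show ?thesis using 3 by (simp add: rtrancl_into_rtrancl)
    qed
  qed simp
  have "V - X \<noteq> {}"
  proof
    assume e: "V - X = {}"
    then obtain x where x: "x \<in> X" using con by (auto simp: conn_def)
    then obtain n where "(x, n) \<in> E" using leaf_nbr assms(2) by (metis subsetD)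
    then show False using e EV assms(3)[OF x] by blast
  qed
  moreover have "(x, y) \<in> (del X E)\<^sup>*" if "x \<in> V - X" "y \<in> V - X" for x y
  proof -
    have "(x, y) \<in> E\<^sup>*" using con that unfolding conn_def by blast
    then show ?thesis using reach[of x y] that by simp
  qed
  ultimately have conn: "conn (V - X) (del X E)" by (auto simp: conn_def)
  \<comment> \<open>The arcs leaving \<open>X\<close>; the converse consists of the arcs entering
    \<open>X\<close>. Independence of \<open>X\<close> makes the two disjoint, so two arcs disappear
    per leaf.\<close>
  let ?P = "Sigma X (\<lambda>x. E `` {x})"
  have cP: "card ?P = card X"
  proof -
    have "card (E `` {x}) = 1" if "x \<in> X" for x using that assms(2) by (auto simp: lf_def)
    then show ?thesis using fX sgraph_Image_finite[OF sg] by simp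
  qed
  have fP: "finite ?P" using fX sgraph_Image_finite[OF sg] by (rule finite_SigmaI)
  have E: "E = del X E \<union> (?P \<union> ?P\<inverse>)" using sym by (auto simp: del_def dest: symD)
  have "?P \<inter> ?P\<inverse> = {}" using assms(3) by auto
  then have "card (?P \<union> ?P\<inverse>) = 2 * card X" using cP fP by (simp add: card_Un_disjoint)
  moreover have "del X E \<inter> (?P \<union> ?P\<inverse>) = {}" by (auto simp: del_def)
  moreover have "finite (del X E)" using sgraph_finite[OF sg] by (rule rev_finite_subset) (auto simp: del_def)
  ultimately have "card E = card (del X E) + 2 * card X"
    using E fP by (metis card_Un_disjoint finite_Un finite_converse)
  then have "card (del X E) + 2 = 2 * card (V - X)"
    using cE XV fX card_mono[OF fV XV] by (simp add: card_Diff_subset)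
  then show ?thesis using conn del_sgraph[OF sg] by (simp add: etree_def)
qed

text \<open>All vertices except the two leaves have degree 2 and are suppressed. What remains is a
  single edge, which is biconnected because deleting one end leaves one vertex; the new edge
  \<open>{x, y}\<close> satisfies the second alternative in \<open>biconn_through\<close>.\<close>

lemma biconn_path:
  assumes "etree V E" "lf V E = {x, y}" "x \<noteq> y"
  shows "biconn V (E \<union> {(x, y), (y, x)})"
proof -
  have sg: "sgraph V E" and con: "conn V E"
    using assms(1) by (auto simp: etree_def)
  have fV: "finite V" using sg by (auto simp: sgraph_def)
  have xyV: "{x, y} \<subseteq> V" using assms(2) by (auto simp: lf_def)
  then have cV: "2 \<le> card V" using assms(3) by (metis card_2_iff card_mono fV)
  have "card (lf V E) = 2" using assms(2,3) by simp
  then have le: "\<forall>v\<in>V. card (E `` {v}) \<le> 2" using card_leaves_2_iff[OF assms(1) cV] by simp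
  let ?W = "V - {x, y}"
  have W: "?W \<subseteq> {v \<in> V. card (E `` {v}) = 2}"
  proof
    fix v assume v: "v \<in> ?W"
    then have "card (E `` {v}) \<noteq> 1" using assms(2) by (auto simp: lf_def)
    moreover have "v \<in> V" using v by blast
    ultimately show "v \<in> {v \<in> V. card (E `` {v}) = 2}"
      using bspec[OF le, of v] deg_pos[OF sg con cV, of v] by simp
  qed
  have VW: "V - ?W = {x, y}" using xyV by blast
  have t: "sgraph {x, y} (through ?W E)" "conn {x, y} (through ?W E)"
    using etree_through(1)[OF assms(1) W] VW by (auto simp: etree_def)
  have "biconn {x, y} (through ?W E \<union> {(x, y), (y, x)})"
  proof (rule biconnI)
    show "conn {x, y} (through ?W E \<union> {(x, y), (y, x)})"
      using t(2) by (rule conn_mono) auto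
    show "conn ({x, y} - {v}) (del {v} (through ?W E \<union> {(x, y), (y, x)}))"
      if "v \<in> {x, y}" for v
    proof -
      have "{x, y} - {v} = {y} \<or> {x, y} - {v} = {x}" using that assms(3) by auto
      then show ?thesis using conn_singleton by metis
    qed
  qed (use t(1) in \<open>auto simp: sgraph_def\<close>)
  then show ?thesis
    using biconn_through[OF assms(1) W, of "{(x, y), (y, x)}"] VW by (auto simp: sym_def)
qed

text \<open>For a contracted tree the counted set is the set of representatives. The branch vertex
  \<open>r\<close> prevents two leaves from being adjacent, so all leaves can be removed at
  once.\<close>

lemma card_branch_at_leaves:
  assumes "etree V E" "\<forall>v\<in>V. card (E `` {v}) \<noteq> 2" "r \<in> V" "3 \<le> card (E `` {r})"
    and "2 \<le> card (V - lf V E)"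
  shows "2 \<le> card {c \<in> V. 3 \<le> card (E `` {c}) \<and> E `` {c} \<inter> lf V E \<noteq> {}}"
proof -
  let ?L = "lf V E"
  have sg: "sgraph V E" and con: "conn V E"
    using assms(1) by (auto simp: etree_def)
  have fV: "finite V" and EV: "E \<subseteq> V \<times> V" using sg by (auto simp: sgraph_def)
  have rL: "r \<notin> ?L" using assms(4) by (simp add: lf_def)
  have core: "etree (V - ?L) (del ?L E)"
  proof (rule etree_del_leaves[OF assms(1)])
    fix x y assume xy: "x \<in> ?L" "(x, y) \<in> E"
    show "y \<notin> ?L"
    proof
      assume "y \<in> ?L"
      then have "r \<in> {x, y}" using adjacent_leaves[OF sg con xy(2,1)] assms(3) by blast
      then show False using rL xy \<open>y \<in> ?L\<close> by blast
    qed
  qed simp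
  have cV: "2 \<le> card V" using assms(5) card_mono[OF fV, of "V - ?L"] by force
  have "lf (V - ?L) (del ?L E) \<subseteq> {c \<in> V. 3 \<le> card (E `` {c}) \<and> E `` {c} \<inter> ?L \<noteq> {}}"
  proof
    fix c assume "c \<in> lf (V - ?L) (del ?L E)"
    then have c: "c \<in> V" "c \<notin> ?L" "card (del ?L E `` {c}) = 1" by (auto simp: lf_def)
    then have "card (E `` {c}) \<noteq> 1" by (simp add: lf_def)
    then have d3: "3 \<le> card (E `` {c})"
      using deg_pos[OF sg con cV c(1)] bspec[OF assms(2) c(1)] by linarith
    moreover have "E `` {c} \<inter> ?L \<noteq> {}"
    proof
      assume "E `` {c} \<inter> ?L = {}"
      then have "E `` {c} = del ?L E `` {c}" using c(2) by (auto simp: del_def)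
      then show False using d3 c(3) by simp
    qed
    ultimately show "c \<in> {c \<in> V. 3 \<le> card (E `` {c}) \<and> E `` {c} \<inter> ?L \<noteq> {}}"
      using c(1) by blast
  qed
  moreover have "2 \<le> card (lf (V - ?L) (del ?L E))"
    using card_leaves[OF core assms(5)] by simp
  moreover have "finite {c \<in> V. 3 \<le> card (E `` {c}) \<and> E `` {c} \<inter> ?L \<noteq> {}}"
    using fV by simp
  ultimately show ?thesis by (meson card_mono order.trans)
qed

section \<open>Trees as digraphs, and path-to-edge contraction\<close>

abbreviation edges :: "'a set set \<Rightarrow> 'a rel" where
  "edges F \<equiv> {(u, v). {u, v} \<in> F}"

text \<open>The library symmetrises the arcs and keeps walks inside the vertex set; under the
  assumptions neither changes reachability.\<close>

lemma connected_iff_conn: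
  assumes "sym (arcs_ends H)" "arcs_ends H \<subseteq> verts H \<times> verts H"
  shows "connected H \<longleftrightarrow> conn (verts H) (arcs_ends H)"
proof -
  have "arcs_ends H = (\<lambda>e. (tail H e, head H e)) ` arcs H"
    by (simp add: arcs_ends_def arc_to_ends_def)
  then have p: "parcs (mk_symmetric H) = arcs_ends H"
    using assms(1) by (auto simp: parcs_mk_symmetric dest: symD)
  have "(u, v) \<in> rtrancl_on (verts H) (arcs_ends H) \<longleftrightarrow> (u, v) \<in> (arcs_ends H)\<^sup>*"
    if "u \<in> verts H" "v \<in> verts H" for u v
  proof
    assume "(u, v) \<in> (arcs_ends H)\<^sup>*"
    then show "(u, v) \<in> rtrancl_on (verts H) (arcs_ends H)"
      by (rule rtrancl_consistent_rtrancl_on) (use that assms(2) in auto)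
  qed (rule rtrancl_on_rtranclI)
  then show ?thesis
    by (auto simp: connected_def strongly_connected_def reachable_def conn_def p)
qed

lemma two_vertex_connected_iff_biconn:
  assumes "sym (parcs G)" "parcs G \<subseteq> pverts G \<times> pverts G"
  shows "two_vertex_connected G \<longleftrightarrow> biconn (pverts G) (parcs G)"
proof -
  have d: "verts (pre_digraph.del_vert (with_proj G) v) = pverts G - {v}"
    "arcs_ends (pre_digraph.del_vert (with_proj G) v) = del {v} (parcs G)" for v
    by (auto simp: pre_digraph.del_vert_def arcs_ends_def arc_to_ends_def del_def image_iff)
  have c: "connected (pre_digraph.del_vert (with_proj G) v) \<longleftrightarrow> conn (pverts G - {v}) (del {v} (parcs G))" for v
  proof -
    have "del {v} (parcs G) \<subseteq> (pverts G - {v}) \<times> (pverts G - {v})"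
      using assms(2) by (auto simp: del_def)
    then show ?thesis
      using connected_iff_conn[of "pre_digraph.del_vert (with_proj G) v", unfolded d]
        sym_del[OF assms(1)] by blast
  qed
  have c': "connected (with_proj G) \<longleftrightarrow> conn (pverts G) (parcs G)"
    using connected_iff_conn[of "with_proj G"] assms by simp
  show ?thesis
  proof
    assume "two_vertex_connected G"
    then show "biconn (pverts G) (parcs G)"
      by (intro biconnI assms(2)) (simp_all add: two_vertex_connected_def c c')
  qed (simp add: two_vertex_connected_def c c' biconn_conn conn_del)
qed

lemma two_vertex_connected_add_edges:
  assumes "sgraph (pverts G) (parcs G)" "edges F \<subseteq> pverts G \<times> pverts G"
  shows "two_vertex_connected (add_edges G F) \<longleftrightarrow> biconn (pverts G) (parcs G \<union> edges F)"
proof -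
  have "sym (edges F)" by (auto simp: sym_def insert_commute)
  then show ?thesis
    using two_vertex_connected_iff_biconn[of "add_edges G F"] assms
    by (auto simp: add_edges_def sgraph_def sym_Un)
qed

text \<open>A spanning tree \<open>H\<close> must be everything: an arc \<open>(u, v)\<close>
  outside \<open>H\<close> would close the path of \<open>H\<close> from \<open>v\<close> to
  \<open>u\<close> to a cycle.\<close>

lemma undirected_tree_etree:
  assumes "undirected_tree T"
  shows "etree (pverts T) (parcs T)"
proof -
  interpret pair_graph T using assms by (simp add: undirected_tree_def)
  have sg: "sgraph (pverts T) (parcs T)"
    using pair_finite_verts pair_sym_arcs pair_no_loops wellformed'
    by (fastforce simp: sgraph_def symmetric_def irrefl_def)
  have "conn (pverts T) (parcs T)"
    using assms connected_iff_conn[of "with_proj T"] sg by (simp add: undirected_tree_def sgraph_def)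
  then obtain H where H: "H \<subseteq> parcs T" "etree (pverts T) H"
    using spanning_etree[OF sg] by blast
  have "H = parcs T"
  proof (rule ccontr)
    assume "H \<noteq> parcs T"
    then obtain u v where uv: "(u, v) \<in> parcs T" "(u, v) \<notin> H" using H(1) by auto
    have sgH: "sgraph (pverts T) H" "conn (pverts T) H" using H(2) by (auto simp: etree_def)
    have vu: "(v, u) \<notin> H" using uv(2) sgH(1) by (auto simp: sgraph_def dest: symD)
    have V: "u \<in> pverts T" "v \<in> pverts T" "u \<noteq> v"
      using uv(1) sg by (auto simp: sgraph_def irrefl_def)
    let ?H = "\<lparr>pverts = pverts T, parcs = H\<rparr>"
    interpret H: pair_wf_digraph ?H using sgH(1) by unfold_locales (auto simp: sgraph_def)
    have "connected (with_proj ?H)"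
      using connected_iff_conn[of "with_proj ?H"] sgH by (simp add: sgraph_def)
    then have "(v, u) \<in> H\<^sup>*" using sgH(2) V by (auto simp: conn_def)
    then have "v \<rightarrow>\<^sup>*\<^bsub>with_proj ?H\<^esub> u"
      unfolding reachable_def using sgH(1) V
      by (intro rtrancl_consistent_rtrancl_on) (auto simp: sgraph_def)
    then obtain p where "H.apath v p u" using H.reachable_apath by auto
    then have p: "set p \<subseteq> H" "pcas v p u" "distinct (pawalk_verts v p)"
      by (auto simp: H.apath_def H.awalk_def)
    \<comment> \<open>Needed for a cycle of length at least 3: a shorter \<open>p\<close> would
      require \<open>v = u\<close> or the arc \<open>(v, u)\<close> in \<open>H\<close>.\<close>
    have "2 \<le> length p"
    proof (rule ccontr)
      assume "\<not> 2 \<le> length p"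
      then consider "p = []" | e where "p = [e]"
        by (metis One_nat_def Suc_1 Suc_leI length_0_conv length_Suc_conv less_one linorder_neqE_nat not_le)
      then show False using p V vu by cases auto
    qed
    then have "cycle ((u, v) # p) \<and> 3 \<le> length ((u, v) # p)"
      using p H(1) V uv(1) unfolding cycle_def awalk_def by (intro conjI exI[of _ u]) auto
    then show False using assms unfolding undirected_tree_def by blast
  qed
  then show ?thesis using H(2) by simp
qed

lemma deg_eq: "deg G v = card (parcs G `` {v})"
proof -
  have "out_arcs (with_proj G) v = Pair v ` (parcs G `` {v})"
    by (auto simp: out_arcs_def)
  then show ?thesis by (simp add: out_degree_def card_image inj_on_def)
qed

lemma leaves_eq: "leaves G = lf (pverts G) (parcs G)"
  by (simp add: leaves_def lf_def deg_eq)

section \<open>Walks, paths and contraction as suppression\<close>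

lemma vwalk_Cons2:
  "vwalk (x # y # p) (with_proj G) \<longleftrightarrow> x \<in> pverts G \<and> (x, y) \<in> parcs G \<and> vwalk (y # p) (with_proj G)"
  by (auto simp: vwalk_def)

lemma vwalk_snoc:
  "p \<noteq> [] \<Longrightarrow> vwalk p (with_proj G) \<Longrightarrow> (last p, y) \<in> parcs G \<Longrightarrow> y \<in> pverts G \<Longrightarrow>
   vwalk (p @ [y]) (with_proj G)"
  by (auto simp: vwalk_def vwalk_arcs_append)

lemma inner_Cons2: "inner (x # y # z # p) = insert y (inner (y # z # p))"
  by (simp add: inner_def)

lemma inner_subset: "inner p \<subseteq> set p"
  by (cases p) (auto simp: inner_def dest: in_set_butlastD)

text \<open>The conclusion is the bare composition and not \<open>through W (parcs G)\<close>,
  because the induction passes to tails that start inside \<open>W\<close>.\<close>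

lemma vwalk_imp_through:
  assumes "vwalk p (with_proj G)" "2 \<le> length p" "inner p \<subseteq> W"
  shows "(hd p, last p) \<in> (parcs G \<inter> UNIV \<times> W)\<^sup>* O parcs G"
  using assms
proof (induction p rule: induct_list012)
  case (3 x y p)
  show ?case
  proof (cases p)
    case Nil
    then show ?thesis using 3 by (auto simp: vwalk_Cons2)
  next
    case (Cons z q)
    then have "(y, last p) \<in> (parcs G \<inter> UNIV \<times> W)\<^sup>* O parcs G"
      using 3 by (auto simp: vwalk_Cons2 inner_Cons2)
    moreover have "(x, y) \<in> parcs G \<inter> UNIV \<times> W"
      using 3 Cons by (auto simp: vwalk_Cons2 inner_Cons2)
    ultimately show ?thesis using Cons
      by (auto intro: relcompI[OF converse_rtrancl_into_rtrancl])
  qed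
qed auto

text \<open>The walk behind the suppressed arc is shortened to a path on some of its vertices;
  \<open>u \<noteq> v\<close> keeps it from shrinking to a point.\<close>

lemma through_imp_vpath:
  assumes "parcs G \<subseteq> pverts G \<times> pverts G" "(u, v) \<in> through W (parcs G)"
  obtains p where "vpath p (with_proj G)" "hd p = u" "last p = v" "2 \<le> length p"
    "set p \<subseteq> insert u (insert v W)"
proof -
  obtain z where z: "(u, z) \<in> (parcs G \<inter> UNIV \<times> W)\<^sup>*" "(z, v) \<in> parcs G" and uv: "u \<noteq> v"
    using assms(2) by (auto simp: through_def)
  have u: "u \<in> pverts G"
    using z assms(1) by (blast elim: converse_rtranclE)
  have "\<exists>p. vwalk p (with_proj G) \<and> hd p = u \<and> last p = z \<and> set p \<subseteq> insert u W"
    using z(1)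
  proof induction
    case base
    then show ?case using u by (intro exI[of _ "[u]"]) (auto simp: vwalk_def)
  next
    case (step y z)
    then obtain p where p: "vwalk p (with_proj G)" "hd p = u" "last p = y" "set p \<subseteq> insert u W" by blast
    have "p \<noteq> []" using p(1) by (auto simp: vwalk_def)
    then show ?case
      using p step(2) assms(1) by (intro exI[of _ "p @ [z]"]) (auto intro!: vwalk_snoc)
  qed
  then obtain p where p: "vwalk p (with_proj G)" "hd p = u" "last p = z" "set p \<subseteq> insert u W" by blast
  have ne: "p \<noteq> []" using p(1) by (auto simp: vwalk_def)
  have q: "vwalk (p @ [v]) (with_proj G)" "hd (p @ [v]) = u"
    using p z(2) assms(1) ne by (auto intro!: vwalk_snoc)
  let ?q = "vwalk_to_vpath (p @ [v])"
  have h: "hd ?q = u" "last ?q = v" "?q \<noteq> []"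
    using q vwalk_to_vpath_nonempty[of "p @ [v]"] by (simp_all add: vwalk_to_vpath_hd vwalk_to_vpath_last)
  then have "2 \<le> length ?q" using uv by (cases ?q rule: remdups_adj.cases) auto
  moreover have "set ?q \<subseteq> insert u (insert v W)"
    using vwalk_to_vpath_subset[of _ "p @ [v]"] p(4) by auto
  ultimately show thesis using that vwalk_to_vpath_vpath[OF q(1)] h by blast
qed

lemma inner_vpath:
  assumes "vpath p G" "2 \<le> length p"
  shows "set p = insert (hd p) (insert (last p) (inner p))" "hd p \<notin> inner p" "last p \<notin> inner p"
    "hd p \<noteq> last p"
proof -
  obtain x q where q: "p = x # q" "q \<noteq> []" using assms(2)
    by (cases p rule: remdups_adj.cases) auto
  then obtain r y where r: "p = x # r @ [y]" by (metis rev_exhaust)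
  then show "set p = insert (hd p) (insert (last p) (inner p))" "hd p \<notin> inner p" "last p \<notin> inner p"
    "hd p \<noteq> last p" using assms(1) by (auto simp: inner_def vpath_def)
qed

text \<open>Only the orientation needs care, since a \<open>contractible_path\<close> starts at
  degree at least 3. This is why the ends are recovered as an unordered pair.\<close>

lemma contractible_path_exists:
  assumes tree: "etree (pverts T) (parcs T)" and r: "r \<in> pverts T" "3 \<le> deg T r"
    and W: "W = {v \<in> pverts T. deg T v = 2}" and uv: "(u, v) \<in> through W (parcs T)"
  obtains p where "contractible_path T p" "{hd p, last p} = {u, v}" "set p \<subseteq> insert u (insert v W)"
proof -
  have sg: "sgraph (pverts T) (parcs T)" and con: "conn (pverts T) (parcs T)"
    using tree by (auto simp: etree_def)
  have fV: "finite (pverts T)" and EV: "parcs T \<subseteq> pverts T \<times> pverts T" using sg by (auto simp: sgraph_def)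
  have W2: "W \<subseteq> {v \<in> pverts T. card (parcs T `` {v}) = 2}" using W by (simp add: deg_eq)
  note t = etree_through[OF tree W2]
  have sgt: "sgraph (pverts T - W) (through W (parcs T))" "conn (pverts T - W) (through W (parcs T))"
    using t(1) by (auto simp: etree_def)
  have V: "u \<in> pverts T - W" "v \<in> pverts T - W" "u \<noteq> v"
    using sgt(1) uv by (auto simp: sgraph_def irrefl_def)
  then have "2 \<le> card (pverts T)" using fV by (metis DiffE card_2_iff card_mono empty_subsetI insert_subset)
  then have d: "1 \<le> deg T x \<and> deg T x \<noteq> 2" if "x \<in> pverts T - W" for x
    using deg_pos[OF sg con] that by (auto simp: W deg_eq)
  have rW: "r \<in> pverts T - W" using r by (simp add: W)
  \<comment> \<open>Two adjacent leaves would make up the whole suppressed tree, but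
    \<open>r\<close> remains in it.\<close>
  have "\<not> (deg T u = 1 \<and> deg T v = 1)"
  proof
    assume "deg T u = 1 \<and> deg T v = 1"
    then have "u \<in> lf (pverts T - W) (through W (parcs T))" "v \<in> lf (pverts T - W) (through W (parcs T))"
      using t(2) V by (simp_all add: lf_def deg_eq)
    then have "r = u \<or> r = v" using adjacent_leaves[OF sgt uv] rW by blast
    then show False using r(2) \<open>deg T u = 1 \<and> deg T v = 1\<close> by auto
  qed
  then consider "3 \<le> deg T u" | "3 \<le> deg T v" using d[OF V(1)] d[OF V(2)] by linarith
  then obtain a b where ab: "{a, b} = {u, v}" "3 \<le> deg T a" by cases (auto simp: insert_commute)
  have abt: "(a, b) \<in> through W (parcs T)"
    using ab(1) uv sgt(1) by (auto simp: sgraph_def doubleton_eq_iff dest: symD)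
  obtain p where p: "vpath p (with_proj T)" "hd p = a" "last p = b" "2 \<le> length p"
    "set p \<subseteq> insert a (insert b W)"
    using through_imp_vpath[OF EV abt] by blast
  note i = inner_vpath[OF p(1,4)]
  have "b \<in> pverts T - W" using ab(1) V by (auto simp: doubleton_eq_iff)
  then have "3 \<le> deg T b \<or> b \<in> leaves T" using d[of b] by (force simp: leaves_def)
  moreover have "inner p \<subseteq> W" using i p(2,3,5) by auto
  ultimately have "contractible_path T p"
    using p ab(2) unfolding contractible_path_def W by blast
  moreover have "{hd p, last p} = {u, v}" "set p \<subseteq> insert u (insert v W)"
    using p ab(1) by (auto simp: doubleton_eq_iff)
  ultimately show thesis using that by blast
qed

text \<open>To find a path through a given \<open>w\<close> of degree 2, all of \<open>W\<close>
  except \<open>w\<close> is suppressed; the two neighbours that \<open>w\<close> then has are the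
  ends of the path.\<close>

lemma Union_inner_contractible:
  assumes tree: "etree (pverts T) (parcs T)" and r: "r \<in> pverts T" "3 \<le> deg T r"
    and W: "W = {v \<in> pverts T. deg T v = 2}"
  shows "(\<Union>p\<in>{p. contractible_path T p}. inner p) = W"
proof
  show "(\<Union>p\<in>{p. contractible_path T p}. inner p) \<subseteq> W"
  proof
    fix w assume "w \<in> (\<Union>p\<in>{p. contractible_path T p}. inner p)"
    then obtain p where p: "contractible_path T p" "w \<in> inner p" by blast
    then have "set p \<subseteq> pverts T" "deg T w = 2"
      by (auto simp: contractible_path_def vpath_def vwalk_def)
    then show "w \<in> W" using p(2) inner_subset[of p] by (auto simp: W)
  qed
  show "W \<subseteq> (\<Union>p\<in>{p. contractible_path T p}. inner p)"
  proof
    fix w assume w: "w \<in> W"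
    let ?W = "W - {w}" and ?E = "through (W - {w}) (parcs T)"
    have W2: "?W \<subseteq> {v \<in> pverts T. card (parcs T `` {v}) = 2}" using W by (auto simp: deg_eq)
    note t = etree_through[OF tree W2]
    have wV: "w \<in> pverts T - ?W" using w W by blast
    have "card (?E `` {w}) = 2" using t(2) wV w W by (simp add: deg_eq)
    then obtain a b where ab: "?E `` {w} = {a, b}" "a \<noteq> b" by (rule deg2_nbrs)
    note s = etree_suppress[OF t(1) wV ab]
    have sg: "sgraph (pverts T - ?W) ?E" using t(1) by (simp add: etree_def)
    have "through {w} ?E = through W (parcs T)"
      using through_through[of w ?W "parcs T"] w by (simp add: insert_absorb)
    then have "(a, b) \<in> through W (parcs T)" using s(2) by auto
    then obtain p where p: "contractible_path T p" "{hd p, last p} = {a, b}"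
      "set p \<subseteq> insert a (insert b W)"
      using contractible_path_exists[OF tree r W] by blast
    have vp: "vpath p (with_proj T)" "2 \<le> length p" using p(1) by (auto simp: contractible_path_def)
    note i = inner_vpath[OF vp]
    \<comment> \<open>Otherwise \<open>a\<close> and \<open>b\<close> stay adjacent when all of \<open>W\<close> but \<open>w\<close> is suppressed, and form a triangle
      with \<open>w\<close>.\<close>
    have "w \<in> inner p"
    proof (rule ccontr)
      assume "w \<notin> inner p"
      then have "inner p \<subseteq> ?W" using i p(2,3) by (auto simp: doubleton_eq_iff)
      then have "(hd p, last p) \<in> (parcs T \<inter> UNIV \<times> ?W)\<^sup>* O parcs T"
        using vwalk_imp_through vp by (auto simp: vpath_def)
      moreover have "a \<notin> ?W" "b \<notin> ?W" using ab(1) sg by (auto simp: sgraph_def)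
      ultimately have "(hd p, last p) \<in> ?E"
        using i(4) p(2) by (auto simp: through_def doubleton_eq_iff)
      then show False using s(3) p(2) sg by (auto simp: sgraph_def doubleton_eq_iff dest: symD)
    qed
    then show "w \<in> (\<Union>p\<in>{p. contractible_path T p}. inner p)" using p(1) by blast
  qed
qed

text \<open>Brings contraction under the suppression lemmas. Contractible paths have their interiors
  in \<open>W\<close> and their ends outside, and \<open>contractible_path_exists\<close> gives the
  converse.\<close>

lemma contract_eq_through:
  assumes tree: "etree (pverts T) (parcs T)" and r: "r \<in> pverts T" "3 \<le> deg T r"
    and W: "W = {v \<in> pverts T. deg T v = 2}"
  shows "contract T = \<lparr>pverts = pverts T - W, parcs = through W (parcs T)\<rparr>"
proof -
  have sg: "sgraph (pverts T) (parcs T)" using tree by (auto simp: etree_def)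
  then have irr: "irrefl (parcs T)" by (simp add: sgraph_def)
  have W2: "W \<subseteq> {v \<in> pverts T. card (parcs T `` {v}) = 2}" using W by (simp add: deg_eq)
  have sgt: "sgraph (pverts T - W) (through W (parcs T))"
    using etree_through[OF tree W2] by (simp add: etree_def)
  have ends: "(hd p, last p) \<in> through W (parcs T)" if p: "contractible_path T p" for p
  proof -
    have vp: "vpath p (with_proj T)" "2 \<le> length p" using p by (auto simp: contractible_path_def)
    have "inner p \<subseteq> W" using Union_inner_contractible[OF tree r W] p by blast
    then have "(hd p, last p) \<in> (parcs T \<inter> UNIV \<times> W)\<^sup>* O parcs T"
      using vwalk_imp_through vp by (auto simp: vpath_def)
    moreover have "hd p \<notin> W" "last p \<notin> W"
      using p by (auto simp: contractible_path_def W leaves_def)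
    ultimately show ?thesis using inner_vpath(4)[OF vp] by (auto simp: through_def)
  qed
  have "del W (parcs T) \<union> edges {{hd p, last p} | p. contractible_path T p} = through W (parcs T)"
  proof (intro equalityI subrelI)
    fix u v assume "(u, v) \<in> del W (parcs T) \<union> edges {{hd p, last p} | p. contractible_path T p}"
    then show "(u, v) \<in> through W (parcs T)"
    proof
      assume "(u, v) \<in> del W (parcs T)"
      then show ?thesis using irr by (auto simp: del_def through_def irrefl_def)
    next
      assume "(u, v) \<in> edges {{hd p, last p} | p. contractible_path T p}"
      then obtain p where "contractible_path T p" "{u, v} = {hd p, last p}" by blast
      then show ?thesis using ends[of p] sgt by (auto simp: doubleton_eq_iff sgraph_def dest: symD)
    qed
  next
    fix u v assume "(u, v) \<in> through W (parcs T)"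
    then obtain p where "contractible_path T p" "{hd p, last p} = {u, v}"
      using contractible_path_exists[OF tree r W] by blast
    then show "(u, v) \<in> del W (parcs T) \<union> edges {{hd p, last p} | p. contractible_path T p}"
      by blast
  qed
  then show ?thesis
    unfolding contract_def Union_inner_contractible[OF tree r W]
    by (simp add: add_edges_def del_verts_def del_def)
qed

lemma contract_no_branch:
  assumes "\<And>r. r \<in> pverts T \<Longrightarrow> deg T r < 3"
  shows "contract T = T"
proof -
  have "\<not> contractible_path T p" for p
  proof
    assume p: "contractible_path T p"
    then have "hd p \<in> pverts T" "3 \<le> deg T (hd p)"
      by (auto simp: contractible_path_def vpath_def vwalk_def)
    then show False using assms by force
  qed
  then show ?thesis by (simp add: contract_def add_edges_def del_verts_def)
qed

lemma contract_branch:
  assumes tree: "etree (pverts T) (parcs T)" and r: "r \<in> pverts T" "3 \<le> deg T r"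
  defines "S \<equiv> contract T"
  shows "etree (pverts S) (parcs S)" "pverts S \<subseteq> pverts T" "r \<in> pverts S"
    and "\<And>v. v \<in> pverts S \<Longrightarrow> deg S v = deg T v \<and> deg S v \<noteq> 2"
    and "\<And>F. F \<subseteq> pverts S \<times> pverts S \<Longrightarrow> sym F \<Longrightarrow> biconn (pverts S) (parcs S \<union> F) \<Longrightarrow>
      biconn (pverts T) (parcs T \<union> F)"
proof -
  define W where "W = {v \<in> pverts T. deg T v = 2}"
  have S: "pverts S = pverts T - W" "parcs S = through W (parcs T)"
    using contract_eq_through[OF tree r W_def] by (simp_all add: S_def)
  have W2: "W \<subseteq> {v \<in> pverts T. card (parcs T `` {v}) = 2}" using W_def by (simp add: deg_eq)
  note t = etree_through[OF tree W2]
  show e: "etree (pverts S) (parcs S)" using t(1) by (simp add: S)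
  show "pverts S \<subseteq> pverts T" by (auto simp: S)
  show rS: "r \<in> pverts S" using r by (simp add: S W_def)
  show d: "deg S v = deg T v \<and> deg S v \<noteq> 2" if "v \<in> pverts S" for v
    using t(2) that by (simp add: S deg_eq W_def)
  show "biconn (pverts T) (parcs T \<union> F)"
    if "F \<subseteq> pverts S \<times> pverts S" "sym F" "biconn (pverts S) (parcs S \<union> F)" for F
  proof (rule biconn_through[OF tree W2])
    \<comment> \<open>The three neighbours of \<open>r\<close> provide the three vertices that
      \<open>biconn_through\<close> asks for.\<close>
    have "sgraph (pverts S) (parcs S)" using e by (simp add: etree_def)
    then have "finite (pverts S)" "parcs S `` {r} \<subseteq> pverts S" by (auto simp: sgraph_def)
    then have "card (parcs S `` {r}) \<le> card (pverts S)" by (rule card_mono)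
    then show "3 \<le> card (pverts T - W) \<or> (\<forall>x\<in>pverts T - W. \<forall>y\<in>pverts T - W. x \<noteq> y \<longrightarrow> (x, y) \<in> F)"
      using d[OF rS] r(2) by (simp add: S deg_eq)
  qed (use that in \<open>simp_all add: S\<close>)
qed

text \<open>Supplies the branch vertex for \<open>contract_branch\<close>: without one, contraction
  changes nothing and the representative itself would be one.\<close>

lemma representatives_contract_branch:
  assumes "q \<in> representatives (contract T)"
  obtains r where "r \<in> pverts T" "3 \<le> deg T r"
proof (cases "\<exists>r\<in>pverts T. 3 \<le> deg T r")
  case False
  then have "contract T = T" using contract_no_branch[of T] by (meson not_le)
  then show thesis using assms that by (auto simp: representatives_def)
qed (use that in blast)

section \<open>The algorithm\<close>

lemma leaves_at_representatives:
  assumes "sgraph (pverts S) (parcs S)" "p \<in> representatives S" "q \<in> representatives S" "p \<noteq> q"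
    and "x \<in> leaves_at S p"
  shows "x \<in> pverts S" "(x, p) \<in> parcs S" "\<And>y. (x, y) \<in> parcs S \<Longrightarrow> y = p"
    "x \<notin> representatives S" "x \<notin> leaves_at S q"
proof -
  have x: "x \<in> lf (pverts S) (parcs S)" "(p, x) \<in> parcs S"
    using assms(5) by (auto simp: leaves_at_def leaves_eq)
  show "x \<in> pverts S" using x(1) by (simp add: lf_def)
  show xp: "(x, p) \<in> parcs S" using x(2) assms(1) by (auto simp: sgraph_def dest: symD)
  show n: "\<And>y. (x, y) \<in> parcs S \<Longrightarrow> y = p" using x(1) xp by (metis leaf_nbr)
  show "x \<notin> representatives S" using x(1) by (auto simp: lf_def representatives_def deg_eq)
  show "x \<notin> leaves_at S q"
    using n[of q] assms(1,4) by (auto simp: leaves_at_def sgraph_def dest: symD)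
qed

text \<open>The deleted leaves have no neighbours except \<open>p\<close> and \<open>q\<close>,
  which are not leaves; so they are independent, as \<open>etree_del_leaves\<close>
  requires.\<close>

lemma etree_del_paired_leaves:
  assumes "etree (pverts S) (parcs S)" "p \<in> representatives S" "q \<in> representatives S" "p \<noteq> q"
    and "X \<subseteq> leaves_at S p" "Y \<subseteq> leaves_at S q"
  shows "etree (pverts (del_verts S (X \<union> Y))) (parcs (del_verts S (X \<union> Y)))"
proof -
  have sg: "sgraph (pverts S) (parcs S)" using assms(1) by (simp add: etree_def)
  note lp = leaves_at_representatives[OF sg assms(2,3,4)]
  note lq = leaves_at_representatives[OF sg assms(3,2) assms(4)[symmetric]]
  have "etree (pverts S - (X \<union> Y)) (del (X \<union> Y) (parcs S))"
  proof (rule etree_del_leaves[OF assms(1)])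
    show "X \<union> Y \<subseteq> lf (pverts S) (parcs S)"
      using assms(5,6) by (auto simp: leaves_at_def leaves_eq)
    fix x y assume "x \<in> X \<union> Y" "(x, y) \<in> parcs S"
    then have "y = p \<or> y = q" using lp(3) lq(3) assms(5,6) by blast
    then show "y \<notin> X \<union> Y" using lp(4) lq(4) assms by blast
  qed
  then show ?thesis by (simp add: del_verts_def del_def)
qed

lemma sym_edges: "sym (edges F)"
  by (auto simp: sym_def insert_commute)

text \<open>Rule induction on the run. The bound on \<open>edges F\<close> is carried along because
  biconnectivity is pulled back through a contraction only for edges between remaining
  vertices.\<close>

lemma tree_augment_biconn:
  assumes "tree_augment T F" "etree (pverts T) (parcs T)"
  shows "edges F \<subseteq> pverts T \<times> pverts T \<and> biconn (pverts T) (parcs T \<union> edges F)"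
  using assms
proof induction
  case (two_leaves T x y)
  have "edges {{x, y}} = {(x, y), (y, x)}" by (auto simp: doubleton_eq_iff)
  then show ?case using two_leaves biconn_path[of "pverts T" "parcs T" x y]
    by (auto simp: leaves_eq lf_def)
next
  case (star T F)
  let ?S = "contract T"
  obtain q where "q \<in> representatives ?S" using star.hyps(2) by (metis card.empty ex_in_conv zero_neq_one)
  then obtain r where r: "r \<in> pverts T" "3 \<le> deg T r" by (rule representatives_contract_branch)
  note S = contract_branch[OF star.prems r]
  have sg: "sgraph (pverts ?S) (parcs ?S)" using S(1) by (simp add: etree_def)
  have "edges F \<subseteq> pverts ?S \<times> pverts ?S"
    using star.hyps(3) by (auto simp: star_augment_def leaves_def)
  moreover have "two_vertex_connected (add_edges ?S F)" using star.hyps(3) by (simp add: star_augment_def)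
  ultimately show ?case
    using two_vertex_connected_add_edges[OF sg] S(2) S(5)[OF _ sym_edges] by blast
next
  case (non_star x y t T S r\<^sub>i r\<^sub>j F)
  let ?X = "x ` {1..t}" and ?Y = "y ` {1..t}"
  let ?P = "(\<lambda>k. {x k, y k}) ` {1..t}"
  let ?S' = "del_verts S (?X \<union> ?Y)"
  have ri: "r\<^sub>i \<in> representatives S" and rj: "r\<^sub>j \<in> representatives S" and ij: "r\<^sub>i \<noteq> r\<^sub>j"
    using non_star.hyps(4,5) by (auto simp: is_arg_max_def)
  obtain r where r: "r \<in> pverts T" "3 \<le> deg T r"
    using representatives_contract_branch ri non_star.hyps(2) by metis
  note S = contract_branch[OF non_star.prems r, folded non_star.hyps(2)]
  have sg: "sgraph (pverts S) (parcs S)" using S(1) by (simp add: etree_def)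
  have del: "pverts ?S' = pverts S - (?X \<union> ?Y)" "parcs ?S' = del (?X \<union> ?Y) (parcs S)"
    by (simp_all add: del_verts_def del_def)
  note lx = leaves_at_representatives[OF sg ri rj ij]
  note ly = leaves_at_representatives[OF sg rj ri ij[symmetric]]
  have IH: "edges F \<subseteq> pverts ?S' \<times> pverts ?S'" "biconn (pverts ?S') (parcs ?S' \<union> edges F)"
    using non_star.IH etree_del_paired_leaves[OF S(1) ri rj ij non_star.hyps(8,10)] by auto
  have xk: "x k \<in> leaves_at S r\<^sub>i" and yk: "y k \<in> leaves_at S r\<^sub>j" if "k \<in> {1..t}" for k
    using that non_star.hyps(8,10) by auto
  let ?F = "edges (?P \<union> F)"
  have sub: "?F \<subseteq> pverts S \<times> pverts S"
  proof (rule subrelI)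
    fix u v assume "(u, v) \<in> ?F"
    then consider "(u, v) \<in> edges F" | k where "k \<in> {1..t}" "{u, v} = {x k, y k}" by auto
    then show "(u, v) \<in> pverts S \<times> pverts S"
    proof cases
      case 1
      then show ?thesis using IH(1) del(1) by blast
    next
      case 2
      then show ?thesis using lx(1)[OF xk] ly(1)[OF yk] by (auto simp: doubleton_eq_iff)
    qed
  qed
  have "biconn (pverts S) (parcs S \<union> ?F)"
  proof (rule biconn_attach[OF IH(2)])
    show "parcs ?S' \<union> edges F \<subseteq> parcs S \<union> ?F" unfolding del by (auto simp: del_def)
    show "sym (parcs S \<union> ?F)" using sg sym_Un[OF _ sym_edges] by (auto simp only: sgraph_def)
    show "pverts ?S' \<subseteq> pverts S" unfolding del by blast
    fix D v z assume D: "D \<subseteq> {v}" and z: "z \<in> pverts S - pverts ?S'" "z \<notin> D"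
    let ?E = "del D (parcs S \<union> ?F)"
    have "?X \<inter> representatives S = {}" "?Y \<inter> representatives S = {}"
      using lx(4)[OF xk] ly(4)[OF yk] by blast+
    then have rV: "r\<^sub>i \<in> pverts ?S'" "r\<^sub>j \<in> pverts ?S'"
      using ri rj unfolding del representatives_def by blast+
    obtain k where k: "k \<in> {1..t}" "z = x k \<or> z = y k" using z(1) unfolding del by auto
    note x = lx(2)[OF xk[OF k(1)]] lx(4)[OF xk[OF k(1)]]
    note y = ly(2)[OF yk[OF k(1)]] ly(4)[OF yk[OF k(1)]]
    have ne: "x k \<noteq> r\<^sub>i" "x k \<noteq> r\<^sub>j" "y k \<noteq> r\<^sub>i" "y k \<noteq> r\<^sub>j" using x(2) y(2) ri rj by auto
    have xy: "(x k, y k) \<in> ?F" "(y k, x k) \<in> ?F" using k(1) by (auto simp: insert_commute)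
    \<comment> \<open>An inner vertex of the ear goes to its own representative or, if that is the
      deleted vertex, over its partner to the other one.\<close>
    show "\<exists>u\<in>pverts ?S' - D. (z, u) \<in> ?E\<^sup>*"
    proof (cases "z = x k")
      case True
      show ?thesis
      proof (cases "r\<^sub>i \<in> D")
        case False
        then have "(z, r\<^sub>i) \<in> ?E" using True z(2) x(1) by (auto simp: del_def)
        then show ?thesis using False rV by blast
      next
        case ri: True
        then have n: "r\<^sub>j \<notin> D" "y k \<notin> D" using D ij ne by auto
        then have "(z, y k) \<in> ?E" "(y k, r\<^sub>j) \<in> ?E" using True z(2) xy y(1) by (auto simp: del_def)
        then have "(z, r\<^sub>j) \<in> ?E\<^sup>*" by (meson converse_rtrancl_into_rtrancl r_into_rtrancl)
        then show ?thesis using n rV by blast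
      qed
    next
      case False
      then have zy: "z = y k" using k(2) by blast
      show ?thesis
      proof (cases "r\<^sub>j \<in> D")
        case False
        then have "(z, r\<^sub>j) \<in> ?E" using zy z(2) y(1) by (auto simp: del_def)
        then show ?thesis using False rV by blast
      next
        case rj: True
        then have n: "r\<^sub>i \<notin> D" "x k \<notin> D" using D ij ne by auto
        then have "(z, x k) \<in> ?E" "(x k, r\<^sub>i) \<in> ?E" using zy z(2) xy x(1) by (auto simp: del_def)
        then have "(z, r\<^sub>i) \<in> ?E\<^sup>*" by (meson converse_rtrancl_into_rtrancl r_into_rtrancl)
        then show ?thesis using n rV by blast
      qed
    qed
  qed
  then show ?case using S(5)[OF sub sym_edges] sub S(2) by blast
qed

section \<open>Existence of a run\<close>

lemma star_augment_exists:
  assumes tree: "etree (pverts S) (parcs S)" and center: "pverts S - leaves S = {r}" and "3 \<le> deg S r"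
  shows "\<exists>F. star_augment S F"
proof -
  let ?V = "pverts S" and ?E = "parcs S" and ?L = "leaves S"
  have sg: "sgraph ?V ?E" and con: "conn ?V ?E" using tree by (auto simp: etree_def)
  have fV: "finite ?V" and EV: "?E \<subseteq> ?V \<times> ?V" and sym: "sym ?E" and irr: "irrefl ?E"
    using sg by (auto simp: sgraph_def)
  have L: "?L \<subseteq> ?V" "r \<notin> ?L" "r \<in> ?V" "?V = insert r ?L" using center by (auto simp: leaves_def)
  have fL: "finite ?L" using L(1) fV by (rule finite_subset)
  have xr: "(x, r) \<in> ?E" if x: "x \<in> ?L" for x
  proof -
    obtain n where n: "(x, n) \<in> ?E" using leaf_nbr x leaves_eq by metis
    have "n \<notin> ?L"
    proof
      assume "n \<in> ?L"
      then have "r \<in> {x, n}" using adjacent_leaves[OF sg con n] x L(3) by (auto simp: leaves_eq)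
      then show False using L(2) x \<open>n \<in> ?L\<close> by blast
    qed
    moreover have "n \<in> pverts S" using n EV by blast
    ultimately have "n = r" using center by blast
    then show ?thesis using n by simp
  qed
  have rx: "(r, x) \<in> ?E" if "x \<in> ?L" for x using xr[OF that] sym by (metis symD)
  have "?E `` {r} = ?L" using rx EV L irr by (auto simp: irrefl_def)
  then have dr: "deg S r = card ?L" by (simp add: deg_eq)
  have max: "Max (deg S ` ?V) = card ?L"
  proof (rule Max_eqI)
    show "card ?L \<in> deg S ` ?V" using dr L(3) by (metis imageI)
    fix d assume "d \<in> deg S ` ?V"
    then obtain v where v: "v \<in> ?V" "d = deg S v" by blast
    show "d \<le> card ?L"
    proof (cases "v = r")
      case False
      then have "v \<in> ?L" using v(1) center by blast
      then have "d = 1" using v(2) unfolding leaves_def by blast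
      then show ?thesis using dr assms(3) by linarith
    qed (use v dr in simp)
  qed (use fV in simp)
  obtain f where f: "bij_betw f {0..<card ?L} ?L" using ex_bij_betw_nat_finite[OF fL] by blast
  have fi: "f i = f j \<longleftrightarrow> i = j" if "i < card ?L" "j < card ?L" for i j
    using f that by (auto simp: bij_betw_def inj_on_eq_iff)
  have fiL: "f i \<in> ?L" if "i < card ?L" for i using f that by (auto simp: bij_betw_def)
  \<comment> \<open>Consecutive leaves of an enumeration are joined to a path, which uses one edge
    fewer than there are leaves.\<close>
  let ?F = "(\<lambda>i. {f i, f (Suc i)}) ` {0..<card ?L - 1}"
  have "inj_on (\<lambda>i. {f i, f (Suc i)}) {0..<card ?L - 1}"
    by (rule inj_onI) (auto simp: doubleton_eq_iff fi)
  then have cF: "card ?F = card ?L - 1" by (simp add: card_image)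
  have sub: "?F \<subseteq> {e. e \<subseteq> ?L \<and> card e = 2}"
    using fiL by (auto simp: fi card_insert_if)
  let ?H = "?E \<union> edges ?F"
  have symH: "sym ?H" using sym sym_edges by (rule sym_Un)
  have eV: "edges ?F \<subseteq> ?V \<times> ?V" using sub L(1) by blast
  have "biconn ?V ?H"
  proof (rule biconnI)
    show "conn ?V ?H" using con by (rule conn_mono) auto
    show "?H \<subseteq> ?V \<times> ?V" using EV eV by blast
    fix v assume v: "v \<in> ?V"
    show "conn (?V - {v}) (del {v} ?H)"
    proof (cases "v = r")
      case False
      show ?thesis
      \<comment> \<open>After deletion of a leaf, the centre alone is the seed and every other leaf
        is adjacent to it.\<close>
      proof (rule conn_extend[OF conn_singleton[of r "{}"] _ sym_del[OF symH]])
        fix z assume "z \<in> ?V - {v} - {r}"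
        then have "(z, r) \<in> del {v} ?H" using xr L(4) False by (auto simp: del_def)
        then show "\<exists>u\<in>{r}. (z, u) \<in> (del {v} ?H)\<^sup>*" by blast
      qed (use False L(3) in auto)
    next
      case True
      \<comment> \<open>After deletion of the centre, the added path still joins every leaf to
        \<open>f 0\<close>.\<close>
      have path: "(f i, f 0) \<in> (del {v} ?H)\<^sup>*" if "i < card ?L" for i
        using that
      proof (induction i)
        case (Suc i)
        have "{f (Suc i), f i} \<in> ?F" using Suc.prems by (auto simp: insert_commute)
        moreover have "f i \<noteq> r" "f (Suc i) \<noteq> r" using fiL Suc.prems L(2) by (metis Suc_lessD)+
        ultimately have "(f (Suc i), f i) \<in> del {v} ?H" using True by (auto simp: del_def)
        moreover have "(f i, f 0) \<in> (del {v} ?H)\<^sup>*" using Suc by simp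
        ultimately show ?case by (rule converse_rtrancl_into_rtrancl)
      qed simp
      have pos: "0 < card ?L" using assms(3) dr by simp
      show ?thesis
      proof (rule conn_extend[OF conn_singleton[of "f 0" "{}"] _ sym_del[OF symH]])
        fix z assume "z \<in> ?V - {v} - {f 0}"
        then have "z \<in> ?L" using L(4) True by blast
        then have "z \<in> f ` {0..<card ?L}" using f by (simp add: bij_betw_def)
        then obtain i where "i < card ?L" "z = f i" by auto
        then show "\<exists>u\<in>{f 0}. (z, u) \<in> (del {v} ?H)\<^sup>*" using path by blast
      qed (use True fiL[OF pos] L in auto)
    qed
  qed
  then have "two_vertex_connected (add_edges S ?F)"
    using two_vertex_connected_add_edges[OF sg eV] by blast
  then have "star_augment S ?F" unfolding star_augment_def max using sub cF by (intro conjI)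
  then show ?thesis by (rule exI)
qed

lemma is_arg_max_exists:
  fixes f :: "'a \<Rightarrow> nat"
  assumes "finite A" "A \<noteq> {}"
  shows "\<exists>m. is_arg_max f (\<lambda>r. r \<in> A) m"
proof -
  obtain m where "m \<in> A" "\<forall>a\<in>A. f a \<le> f m"
    using Max_in[of "f ` A"] Max_ge[of "f ` A"] assms by fastforce
  then show ?thesis by (intro exI[of _ m]) (auto simp: is_arg_max_def not_less)
qed

lemma ex_inj_on_image_subset:
  assumes "finite A" "t \<le> card A"
  shows "\<exists>f :: nat \<Rightarrow> 'a. inj_on f {1..t} \<and> f ` {1..t} \<subseteq> A"
proof -
  obtain f where "bij_betw f {1..card A} A" using ex_bij_betw_nat_finite_1[OF assms(1)] by blast
  then have "inj_on f {1..t}" "f ` {1..t} \<subseteq> A" using assms(2) inj_on_subset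
    by (fastforce simp: bij_betw_def)+
  then show ?thesis by blast
qed

text \<open>The value \<open>l\<^sub>j - 1\<close> occurs only if
  \<open>d\<^sub>j - l\<^sub>j = 1\<close>, where \<open>l\<^sub>j\<close> is at least 2. If
  \<open>d\<^sub>i - l\<^sub>i = 1\<close>, the order of the degrees yields
  \<open>l\<^sub>j \<le> l\<^sub>i\<close>.\<close>

lemma pair_count_bounds:
  assumes "0 < l\<^sub>i" "0 < l\<^sub>j" "l\<^sub>i \<le> d\<^sub>i" "l\<^sub>j < d\<^sub>j" "d\<^sub>j \<le> d\<^sub>i" "3 \<le> d\<^sub>j"
  shows "0 < pair_count d\<^sub>i l\<^sub>i d\<^sub>j l\<^sub>j \<and> pair_count d\<^sub>i l\<^sub>i d\<^sub>j l\<^sub>j \<le> l\<^sub>i \<and> pair_count d\<^sub>i l\<^sub>i d\<^sub>j l\<^sub>j \<le> l\<^sub>j"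
  using assms unfolding pair_count_def
  by (cases "d\<^sub>i - l\<^sub>i = 1"; cases "d\<^sub>j - l\<^sub>j = 1"; cases "l\<^sub>i \<le> l\<^sub>j")
    (simp_all, linarith+)

text \<open>Otherwise \<open>q\<close> and its leaves would form a whole component, leaving no room
  for \<open>p\<close>.\<close>

lemma leaves_at_psubset:
  assumes "etree (pverts S) (parcs S)" "p \<in> representatives S" "q \<in> representatives S" "p \<noteq> q"
  shows "card (leaves_at S q) < deg S q"
proof -
  have sg: "sgraph (pverts S) (parcs S)" and con: "conn (pverts S) (parcs S)"
    using assms(1) by (auto simp: etree_def)
  have "leaves_at S q \<noteq> parcs S `` {q}"
  proof
    assume eq: "leaves_at S q = parcs S `` {q}"
    note l = leaves_at_representatives[OF sg assms(3,2) assms(4)[symmetric]]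
    have "parcs S `` insert q (leaves_at S q) \<subseteq> insert q (leaves_at S q)" using l(3) eq by blast
    then have "pverts S \<subseteq> insert q (leaves_at S q)"
      using conn_closed[OF con, of _ q] assms(3) by (auto simp: representatives_def)
    then have "p \<in> leaves_at S q" using assms(2,4) by (auto simp: representatives_def)
    then show False using l(4) assms(2) by blast
  qed
  then have "leaves_at S q \<subset> parcs S `` {q}" by (auto simp: leaves_at_def)
  then show ?thesis unfolding deg_eq using sgraph_Image_finite[OF sg] by (rule psubset_card_mono[rotated])
qed

text \<open>Induction on the number of vertices. The bound excludes the single vertex, to which no
  rule applies.\<close>

lemma tree_augment_exists:
  assumes "etree (pverts T) (parcs T)" "2 \<le> card (pverts T)"
  shows "\<exists>F. tree_augment T F"
  using assms
proof (induction "card (pverts T)" arbitrary: T rule: less_induct)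
  case less
  show ?case
  proof (cases "card (leaves T) = 2")
    case True
    then obtain x y where "leaves T = {x, y}" "x \<noteq> y" by (meson card_2_iff)
    then have "tree_augment T {{x, y}}" by (rule tree_augment.two_leaves)
    then show ?thesis by (rule exI)
  next
    case False
    then obtain r where r: "r \<in> pverts T" "3 \<le> deg T r"
    proof -
      have "\<exists>v\<in>pverts T. \<not> deg T v \<le> 2"
        using card_leaves_2_iff[OF less.prems] False by (simp add: leaves_eq deg_eq)
      then obtain v where "v \<in> pverts T" "\<not> deg T v \<le> 2" by blast
      then show thesis using that[of v] by linarith
    qed
    define S where "S = contract T"
    note S = contract_branch[OF less.prems(1) r, folded S_def]
    have sg: "sgraph (pverts S) (parcs S)" and con: "conn (pverts S) (parcs S)"
      using S(1) by (auto simp: etree_def)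
    have fS: "finite (pverts S)" using sg by (simp add: sgraph_def)
    have fT: "finite (pverts T)" using less.prems by (simp add: etree_def sgraph_def)
    have r3: "3 \<le> deg S r" using S(3,4) r(2) by simp
    have reps: "representatives S =
        {c \<in> pverts S. 3 \<le> card (parcs S `` {c}) \<and> parcs S `` {c} \<inter> lf (pverts S) (parcs S) \<noteq> {}}"
      by (auto simp: representatives_def leaves_at_def leaves_eq deg_eq)
    have fR: "finite (representatives S)" using fS by (simp add: representatives_def)
    have rL: "r \<in> pverts S - leaves S" using S(3) r3 by (auto simp: leaves_def)
    \<comment> \<open>The number of vertices that are not leaves decides the case: one is the centre
      of a star, while two or more yield two representatives by
      \<open>card_branch_at_leaves\<close>.\<close>
    show ?thesis
    proof (cases "2 \<le> card (pverts S - leaves S)")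
      case core: False
      then have "card (pverts S - leaves S) = 1"
        using rL fS by (metis One_nat_def Suc_1 Suc_leI card_gt_0_iff empty_iff finite_Diff le_antisym not_less_eq_eq)
      then have center: "pverts S - leaves S = {r}" using rL by (metis card_1_singletonE singletonD)
      have "r \<in> representatives S"
      proof -
        have "parcs S `` {r} \<noteq> {}" using r3 unfolding deg_eq by (metis card.empty not_numeral_le_zero)
        then obtain x where x: "(r, x) \<in> parcs S" by auto
        then have "x \<in> pverts S" "x \<noteq> r" using sg by (auto simp: sgraph_def irrefl_def)
        then show ?thesis using x center r3 S(3) by (auto simp: representatives_def leaves_at_def)
      qed
      moreover have "representatives S \<subseteq> pverts S - leaves S"
        by (auto simp: representatives_def leaves_def)
      ultimately have "card (representatives S) = 1"
        using center by (metis card_1_singleton_iff empty_iff subset_singletonD One_nat_def)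
      moreover obtain F where "star_augment S F" using star_augment_exists[OF S(1) center r3] by blast
      ultimately have "tree_augment T F" using tree_augment.star[OF False] unfolding S_def by simp
      then show ?thesis by (rule exI)
    next
      case True
      have deg2: "\<forall>v\<in>pverts S. card (parcs S `` {v}) \<noteq> 2" using S(4) deg_eq[of S] by metis
      have c2: "2 \<le> card (representatives S)"
        unfolding reps using card_branch_at_leaves[OF S(1) deg2 S(3)] r3 True
        by (simp add: deg_eq leaves_eq)
      then have "representatives S \<noteq> {}" by auto
      then obtain r\<^sub>i where ri: "is_arg_max (deg S) (\<lambda>r. r \<in> representatives S) r\<^sub>i"
        using is_arg_max_exists[OF fR] by blast
      have "representatives S - {r\<^sub>i} \<noteq> {}"
        using c2 by (metis Diff_eq_empty_iff card.empty card_insert_le_m1 card_mono finite.emptyI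
            finite.insertI One_nat_def Suc_1 card_1_singleton_iff not_less_eq_eq)
      then obtain r\<^sub>j where rj: "is_arg_max (deg S) (\<lambda>r. r \<in> representatives S - {r\<^sub>i}) r\<^sub>j"
        using is_arg_max_exists[of "representatives S - {r\<^sub>i}"] fR by blast
      have R: "r\<^sub>i \<in> representatives S" "r\<^sub>j \<in> representatives S" "r\<^sub>i \<noteq> r\<^sub>j" "deg S r\<^sub>j \<le> deg S r\<^sub>i"
        using ri rj by (auto simp: is_arg_max_def not_less)
      have fin: "finite (leaves_at S q)" for q using fS by (simp add: leaves_at_def leaves_def)
      define t where "t = pair_count (deg S r\<^sub>i) (card (leaves_at S r\<^sub>i)) (deg S r\<^sub>j) (card (leaves_at S r\<^sub>j))"
      have t: "0 < t" "t \<le> card (leaves_at S r\<^sub>i)" "t \<le> card (leaves_at S r\<^sub>j)"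
        using pair_count_bounds[of "card (leaves_at S r\<^sub>i)" "card (leaves_at S r\<^sub>j)" "deg S r\<^sub>i" "deg S r\<^sub>j"]
          leaves_at_psubset[OF S(1) R(1,2,3)] leaves_at_psubset[OF S(1) R(2,1) R(3)[symmetric]] R fin
        unfolding t_def by (auto simp: representatives_def card_gt_0_iff)
      obtain x where x: "inj_on x {1..t}" "x ` {1..t} \<subseteq> leaves_at S r\<^sub>i"
        using ex_inj_on_image_subset[OF fin t(2)] by blast
      obtain y where y: "inj_on y {1..t}" "y ` {1..t} \<subseteq> leaves_at S r\<^sub>j"
        using ex_inj_on_image_subset[OF fin t(3)] by blast
      let ?X = "x ` {1..t} \<union> y ` {1..t}"
      let ?S = "del_verts S ?X"
      have "etree (pverts ?S) (parcs ?S)" using etree_del_paired_leaves[OF S(1) R(1-3) x(2) y(2)] .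
      \<comment> \<open>Both representatives survive, so the induction hypothesis covers the reduced
        tree.\<close>
      moreover have "2 \<le> card (pverts ?S)"
      proof -
        have "{r\<^sub>i, r\<^sub>j} \<inter> ?X = {}"
          using leaves_at_representatives(4)[OF sg R(1,2,3)]
            leaves_at_representatives(4)[OF sg R(2,1) R(3)[symmetric]] R(1,2) x(2) y(2) by blast
        then have "{r\<^sub>i, r\<^sub>j} \<subseteq> pverts ?S" using R by (auto simp: del_verts_def representatives_def)
        moreover have "card {r\<^sub>i, r\<^sub>j} = 2" using R(3) by simp
        moreover have "finite (pverts ?S)" using fS by (simp add: del_verts_def)
        ultimately show ?thesis by (metis card_mono)
      qed
      \<comment> \<open>As \<open>t\<close> is positive, index 1 names a leaf that is really
        deleted.\<close>
      moreover have "card (pverts ?S) < card (pverts T)"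
      proof (rule psubset_card_mono[OF fT])
        have "x 1 \<in> ?X" using t(1) by auto
        moreover have "x 1 \<in> leaves_at S r\<^sub>i" using x(2) t(1) by (simp add: image_subset_iff)
        then have "x 1 \<in> pverts S" by (simp add: leaves_at_def leaves_def)
        ultimately show "pverts ?S \<subset> pverts T" using S(2) by (auto simp: del_verts_def)
      qed
      ultimately obtain F where "tree_augment ?S F" using less.hyps by blast
      moreover have "card (representatives S) \<noteq> 1" using c2 by simp
      ultimately have "tree_augment T ((\<lambda>k. {x k, y k}) ` {1..t} \<union> F)"
        by (intro tree_augment.non_star[OF False S_def _ ri rj t_def x y])
      then show ?thesis by (rule exI)
    qed
  qed
qed

text \<open>The existence of a run keeps the claim about all runs from being vacuous.\<close>

theorem theorem2:
  fixes T :: "'a pair_pre_digraph"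
  assumes "undirected_tree T"
  shows "(2 \<le> card (pverts T) \<longrightarrow> (\<exists>F. tree_augment T F)) \<and>
    (\<forall>F. tree_augment T F \<longrightarrow> two_vertex_connected (add_edges T F))"
proof -
  have tree: "etree (pverts T) (parcs T)" using assms by (rule undirected_tree_etree)
  then have "sgraph (pverts T) (parcs T)" by (simp add: etree_def)
  then show ?thesis
    using tree_augment_exists[OF tree] tree_augment_biconn[OF _ tree]
      two_vertex_connected_add_edges by blast
qed

end
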